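(* Let $\ell\in\mathbb{N}^+$, $2\le\eta\in\mathbb{N}^+$ and $\sigma>0$. Assume that $\rho_1,\dots,\rho_\ell\in\mathbb{T}^\infty$ satisfy the infinite-dimensional joint Diophantine condition (discrete version for the discrete average, continuous version for the continuous average) and that $F_1,\dots,F_\ell\in\mathcal{G}(\mathbb{T}_\sigma^\infty)$. Then for every fixed $m\in\mathbb{N}^+$, $$\Big|\mathrm{DMW}_N^\ell(\mathcal F)(\theta)-\prod_{j=1}^\ell\Big(\int_{\mathbb{T}^\infty}F_j(\hat\theta)\,d\hat\theta\Big)\Big|=\mathcal{O}(N^{-m})$$ and $$\Big|\mathrm{CMW}_T^\ell(\mathcal F)(\theta)-\prod_{j=1}^\ell\Big(\int_{\mathbb{T}^\infty}F_j(\hat\theta)\,d\hat\theta\Big)\Big|=\mathcal{O}(T^{-m})$$ whenever $N\in\mathbb N^+$ and $T>0$ are sufficiently large.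
   Context: Weight: $w(x)=\exp(-x^{-1}(1-x)^{-1})\big(\int_0^1\exp(-t^{-1}(1-t)^{-1})dt\big)^{-1}$ for $x\in(0,1)$ and $w(x)=0$ otherwise. Torus and rotations: $\mathbb{T}^\infty=\mathbb{T}^{\mathbb N}$ (with $0\in\mathbb N$), with the product probability measure; rotation vectors are taken in the cube $[1,2]^{\mathbb N}$, identified with $\mathbb{T}^\infty$. For $s\ge0$, $\mathscr{T}_\rho^s(\theta)=\theta+s\rho\bmod 1$ in each coordinate. Averages (for $\theta\in\mathbb{T}^\infty$): with $A_N=\sum_{s=0}^{N-1}w(s/N)$, $$\mathrm{DMW}_N^\ell(\mathcal F)(\theta)=\frac1{A_N}\sum_{n=0}^{N-1}w(n/N)F_1(\mathscr{T}_{\rho_1}^n(\theta))\cdots F_\ell(\mathscr{T}_{\rho_\ell}^n(\theta)),$$ $$\mathrm{CMW}_T^\ell(\mathcal F)(\theta)=\frac1T\int_0^T w(s/T)F_1(\mathscr{T}_{\rho_1}^s(\theta))\cdots F_\ell(\mathscr{T}_{\rho_\ell}^s(\theta))\,ds .$$ For $j\in\mathbb N$, $\langle j\rangle=\max\{1,|j|\}$; $\mathbb{Z}_*^\infty=\{k\in\mathbb{Z}^{\mathbb N}:|k|_\eta:=\sum_{j\in\mathbb N}\langle j\rangle^\eta|k_j|<+\infty\}$; $k\cdot\theta=\sum_j k_j\theta_j$. Analytic functions: $\mathbb{T}_\sigma^\infty=\{\theta=(\theta_j)_{j\in\mathbb N},\ \theta_j\in\mathbb{C}:\operatorname{Re}\theta_j\in\mathbb{T},\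 |\operatorname{Im}\theta_j|\le\sigma\langle j\rangle^\eta\}$, and $\mathcal{G}(\mathbb{T}_\sigma^\infty)$ is the Banach space of functions $u(\theta)=\sum_{k\in\mathbb{Z}_*^\infty}\hat u_ke^{2\pi i k\cdot\theta}$ (scalar coefficients) with $\sum_{k\in\mathbb{Z}_*^\infty}|\hat u_k|e^{2\pi\sigma|k|_\eta}<+\infty$. Infinite-dimensional joint Diophantine condition: for joint integer vectors $k=(k^1,\dots,k^\ell)$ with $k^i=(k^i_j)_{j\in\mathbb N}\in\mathbb{Z}_*^\infty$, and $\tilde\rho=(\rho_1,\dots,\rho_\ell)$, put $k\cdot\tilde\rho=\sum_{i}k^i\cdot\rho_i$. There are $\gamma>0$ and $\mu>1$ such that, for all joint integer vectors $k\neq0$: in the discrete case, $$|k\cdot\tilde\rho-n|>\gamma\prod_{i=1}^{\ell}\prod_{j\in\mathbb N}\big(1+|k^i_j|^\mu\langle j\rangle^\mu\big)^{-1}\quad\text{for all } n\in\mathbb{Z};$$ in the continuous case, the same inequality with $n=0$ only. $\mathcal{O}(\cdot)$ means bounded by a constant, independent of $N$ (resp. $T$), times the argument for all sufficiently large $N$ (resp. $T$). *)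

theory Defs
  imports "HOL-Probability.Probability" "HOL-Library.Landau_Symbols"
begin

definition weight :: "real \<Rightarrow> real" where
  "weight x =
     (if x \<in> {0<..<1}
      then exp (- (inverse x * inverse (1 - x)))
             * inverse (LINT t:{0<..<1}|lborel. exp (- (inverse t * inverse (1 - t))))
      else 0)"

text \<open>The circle is represented by its fundamental domain $[0,1)$, with addition modulo 1.\<close>

definition torus :: "(nat \<Rightarrow> real) set" where
  "torus = {\<theta>. \<forall>j. \<theta> j \<in> {0..<1}}"

definition torus_measure :: "(nat \<Rightarrow> real) measure" where
  "torus_measure = PiM UNIV (\<lambda>_. restrict_space lborel {0..<1})"

text \<open>The rotation vector is a real vector, not a class modulo 1: for non-integer times
  the rotation depends on the chosen representative.\<close>

definition torus_rot :: "(nat \<Rightarrow> real) \<Rightarrow> real \<Rightarrow> (nat \<Rightarrow> real) \<Rightarrow> nat \<Rightarrow> real" where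
  "torus_rot \<rho> s \<theta> = (\<lambda>j. frac (\<theta> j + s * \<rho> j))"

definition jbracket :: "nat \<Rightarrow> real" where
  "jbracket j = max 1 (real j)"

definition int_vecs :: "nat \<Rightarrow> (nat \<Rightarrow> int) set" where
  "int_vecs \<eta> = {k. summable (\<lambda>j. jbracket j ^ \<eta> * \<bar>real_of_int (k j)\<bar>)}"

definition eta_norm :: "nat \<Rightarrow> (nat \<Rightarrow> int) \<Rightarrow> real" where
  "eta_norm \<eta> k = (\<Sum>j. jbracket j ^ \<eta> * \<bar>real_of_int (k j)\<bar>)"

text \<open>Members of \<^term>\<open>int_vecs \<eta>\<close> have finite support, so for them the series below, and the
  infinite product in the Diophantine condition, have only finitely many nontrivial terms.\<close>

definition int_dot :: "(nat \<Rightarrow> int) \<Rightarrow> (nat \<Rightarrow> 'a::real_normed_field) \<Rightarrow> 'a" where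
  "int_dot k x = (\<Sum>j. of_int (k j) * x j)"

definition complex_torus :: "nat \<Rightarrow> real \<Rightarrow> (nat \<Rightarrow> complex) set" where
  "complex_torus \<eta> \<sigma> =
     {\<theta>. \<forall>j. Re (\<theta> j) \<in> {0..<1} \<and> \<bar>Im (\<theta> j)\<bar> \<le> \<sigma> * jbracket j ^ \<eta>}"

text \<open>Only the values of \<open>u\<close> on \<^term>\<open>complex_torus \<eta> \<sigma>\<close> are constrained.\<close>

definition analytic_space :: "nat \<Rightarrow> real \<Rightarrow> ((nat \<Rightarrow> complex) \<Rightarrow> complex) set" where
  "analytic_space \<eta> \<sigma> =
     {u. \<exists>c :: (nat \<Rightarrow> int) \<Rightarrow> complex.
           (\<lambda>k. norm (c k) * exp (2 * pi * \<sigma> * eta_norm \<eta> k)) summable_on int_vecs \<eta> \<and>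
           (\<forall>\<theta>\<in>complex_torus \<eta> \<sigma>.
              ((\<lambda>k. c k * exp (2 * of_real pi * \<i> * int_dot k \<theta>)) has_sum u \<theta>) (int_vecs \<eta>))}"

definition on_torus :: "((nat \<Rightarrow> complex) \<Rightarrow> complex) \<Rightarrow> (nat \<Rightarrow> real) \<Rightarrow> complex" where
  "on_torus u \<theta> = u (\<lambda>j. complex_of_real (\<theta> j))"

definition DMW ::
  "nat \<Rightarrow> (nat \<Rightarrow> nat \<Rightarrow> real) \<Rightarrow> (nat \<Rightarrow> (nat \<Rightarrow> complex) \<Rightarrow> complex)
     \<Rightarrow> nat \<Rightarrow> (nat \<Rightarrow> real) \<Rightarrow> complex" where
  "DMW l \<rho> F N \<theta> =
     1 / complex_of_real (\<Sum>s<N. weight (real s / real N)) *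
       (\<Sum>n<N. complex_of_real (weight (real n / real N)) *
          (\<Prod>i=1..l. on_torus (F i) (torus_rot (\<rho> i) (real n) \<theta>)))"

definition CMW ::
  "nat \<Rightarrow> (nat \<Rightarrow> nat \<Rightarrow> real) \<Rightarrow> (nat \<Rightarrow> (nat \<Rightarrow> complex) \<Rightarrow> complex)
     \<Rightarrow> real \<Rightarrow> (nat \<Rightarrow> real) \<Rightarrow> complex" where
  "CMW l \<rho> F T \<theta> =
     1 / complex_of_real T *
       (LINT s:{0..T}|lborel. complex_of_real (weight (s / T)) *
          (\<Prod>i=1..l. on_torus (F i) (torus_rot (\<rho> i) s \<theta>)))"

text \<open>Joint integer vectors, with components indexed by \<open>{1..l}\<close>.\<close>

definition joint_int_vecs :: "nat \<Rightarrow> nat \<Rightarrow> (nat \<Rightarrow> nat \<Rightarrow> int) set" where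
  "joint_int_vecs \<eta> l = {k. \<forall>i\<in>{1..l}. k i \<in> int_vecs \<eta>}"

definition joint_nonzero :: "nat \<Rightarrow> (nat \<Rightarrow> nat \<Rightarrow> int) \<Rightarrow> bool" where
  "joint_nonzero l k \<longleftrightarrow> (\<exists>i\<in>{1..l}. \<exists>j. k i j \<noteq> 0)"

definition joint_dot :: "nat \<Rightarrow> (nat \<Rightarrow> nat \<Rightarrow> int) \<Rightarrow> (nat \<Rightarrow> nat \<Rightarrow> real) \<Rightarrow> real" where
  "joint_dot l k \<rho> = (\<Sum>i=1..l. int_dot (k i) (\<rho> i))"

definition dioph_bound :: "real \<Rightarrow> real \<Rightarrow> nat \<Rightarrow> (nat \<Rightarrow> nat \<Rightarrow> int) \<Rightarrow> real" where
  "dioph_bound \<gamma> \<mu> l k =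
     \<gamma> * (\<Prod>i=1..l. prodinf (\<lambda>j.
            inverse (1 + \<bar>real_of_int (k i j)\<bar> powr \<mu> * jbracket j powr \<mu>)))"

definition joint_dioph_discrete :: "nat \<Rightarrow> nat \<Rightarrow> (nat \<Rightarrow> nat \<Rightarrow> real) \<Rightarrow> bool" where
  "joint_dioph_discrete \<eta> l \<rho> \<longleftrightarrow>
     (\<exists>\<gamma>>0. \<exists>\<mu>>1. \<forall>k\<in>joint_int_vecs \<eta> l. joint_nonzero l k \<longrightarrow>
        (\<forall>n::int. \<bar>joint_dot l k \<rho> - real_of_int n\<bar> > dioph_bound \<gamma> \<mu> l k))"

definition joint_dioph_continuous :: "nat \<Rightarrow> nat \<Rightarrow> (nat \<Rightarrow> nat \<Rightarrow> real) \<Rightarrow> bool" where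
  "joint_dioph_continuous \<eta> l \<rho> \<longleftrightarrow>
     (\<exists>\<gamma>>0. \<exists>\<mu>>1. \<forall>k\<in>joint_int_vecs \<eta> l. joint_nonzero l k \<longrightarrow>
        \<bar>joint_dot l k \<rho>\<bar> > dioph_bound \<gamma> \<mu> l k)"

end

theory Submission
  imports Defs
begin

text \<open>Expand the observables in Fourier series. Along the orbit of \<open>\<theta>\<close> their product becomes an absolutely
convergent sum over joint modes \<open>k\<close> of characters of time with frequencies \<open>\<alpha> k = joint_dot l k \<rho>\<close>
(\<open>product_along_orbit\<close>), and averaging can be done mode by mode. The zero mode is
reproduced exactly, because the weights have total mass 1 after normalization, and its coefficient is the product of the
means of the observables, because characters other than the trivial one integrate to 0 over the torus
(\<open>coef_zero_mode\<close>). So the error is the sum of the averages of the nonzero modes.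

For a nonzero mode the smoothness of the weight and its flatness at both ends of the unit interval
give cancellation of any polynomial order. Both kinds of average are treated with iterated finite
differences of the weight, which satisfy \<open>\<bar>\<Delta>\<^sub>h ^ m w\<bar> \<le> B h ^ m\<close> (\<open>fdiff_funpow_bound\<close>). For the sum,
\<open>m\<close>-fold summation by parts bounds the average by a constant times \<open>(N \<bar>cis (2 * pi * \<alpha> k) - 1\<bar>) ^ -m\<close>
(\<open>weighted_exponential_sum_bound\<close>). For the integral, \<open>m\<close>-fold translation by half a period gives
a bound by a constant times \<open>(T \<bar>\<alpha> k\<bar>) ^ -m\<close> (\<open>weight_fourier_bound\<close>).

The Diophantine condition bounds the small divisors from below by \<open>\<gamma> / W k\<close>, where \<open>W k\<close> is the product of
the factors \<open>1 + (\<bar>k i j\<bar> \<langle>j\<rangle>) ^ \<mu>\<close> over all \<open>i\<close> and \<open>j\<close>. It remains to see that the coefficients, multiplied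
by \<open>W k ^ m\<close>, are still summable. Since \<open>\<eta> \<ge> 2\<close>, every power of \<open>W k\<close> is dominated by the exponential weight
that is built into the space of analytic functions (\<open>dioph_weight_subexponential\<close>).\<close>

section \<open>Functions with bounded derivatives\<close>

text \<open>Smoothness is only ever used as a quantitative statement about finite differences, so it is
enough to track functions whose first \<open>n\<close> derivatives exist and are bounded. Existence of the
derivative is asserted at each level instead of naming the iterated derivative, which makes
closure under sums and products an easy induction.\<close>

primrec bounded_derivs :: "nat \<Rightarrow> (real \<Rightarrow> real) \<Rightarrow> bool" where
  "bounded_derivs 0 f \<longleftrightarrow> bounded (range f)"
| "bounded_derivs (Suc n) f \<longleftrightarrow> bounded (range f) \<and>
     (\<exists>f'. (\<forall>x. (f has_real_derivative f' x) (at x)) \<and> bounded_derivs n f')"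

lemma bounded_derivs_Suc_imp: "bounded_derivs (Suc n) f \<Longrightarrow> bounded_derivs n f"
  by (induction n arbitrary: f) auto

lemma bounded_derivs_add:
  "bounded_derivs n f \<Longrightarrow> bounded_derivs n g \<Longrightarrow> bounded_derivs n (\<lambda>x. f x + g x)"
proof (induction n arbitrary: f g)
  case 0
  then show ?case
    by (simp add: bounded_plus_comp)
next
  case (Suc n)
  then obtain f' g' where "\<And>x. (f has_real_derivative f' x) (at x)" "bounded_derivs n f'"
    "\<And>x. (g has_real_derivative g' x) (at x)" "bounded_derivs n g'"
    by auto
  moreover from this have "\<forall>x. ((\<lambda>x. f x + g x) has_real_derivative f' x + g' x) (at x)"
    by (auto intro!: derivative_intros)
  ultimately show ?case
    using Suc by (auto simp: bounded_plus_comp)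
qed

lemma bounded_range_mult:
  fixes f g :: "real \<Rightarrow> real"
  assumes "bounded (range f)" "bounded (range g)"
  shows "bounded (range (\<lambda>x. f x * g x))"
proof -
  obtain A B where "\<And>x. \<bar>f x\<bar> \<le> A" "\<And>x. \<bar>g x\<bar> \<le> B"
    using assms by (auto simp: bounded_iff)
  then have "\<bar>f x * g x\<bar> \<le> A * B" for x
    using mult_mono'[of "\<bar>f x\<bar>" A "\<bar>g x\<bar>" B] by (simp add: abs_mult)
  then show ?thesis
    by (auto simp: bounded_iff)
qed

lemma bounded_derivs_mult:
  "bounded_derivs n f \<Longrightarrow> bounded_derivs n g \<Longrightarrow> bounded_derivs n (\<lambda>x. f x * g x)"
proof (induction n arbitrary: f g)
  case 0
  then show ?case
    by (simp add: bounded_range_mult)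
next
  case (Suc n)
  then obtain f' g' where *: "\<And>x. (f has_real_derivative f' x) (at x)" "bounded_derivs n f'"
    "\<And>x. (g has_real_derivative g' x) (at x)" "bounded_derivs n g'"
    by auto
  then have "\<forall>x. ((\<lambda>x. f x * g x) has_real_derivative f' x * g x + g' x * f x) (at x)"
    by (auto intro!: derivative_intros)
  moreover have "bounded_derivs n (\<lambda>x. f' x * g x + g' x * f x)"
    using Suc.prems[THEN bounded_derivs_Suc_imp] *
    by (intro bounded_derivs_add Suc.IH) auto
  ultimately show ?case
    using Suc.prems by (auto simp: bounded_range_mult)
qed

lemma bounded_derivs_const: "bounded_derivs n (\<lambda>x. c)"
proof (induction n arbitrary: c)
  case (Suc n)
  have "\<forall>x. ((\<lambda>x. c) has_real_derivative 0) (at x)"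
    by auto
  then show ?case
    using Suc[of 0] by (auto intro!: exI[of _ "\<lambda>x. 0"])
qed auto

lemma bounded_derivs_reflect: "bounded_derivs n f \<Longrightarrow> bounded_derivs n (\<lambda>x. f (1 - x))"
proof (induction n arbitrary: f)
  case 0
  then show ?case
    by (auto simp: bounded_iff)
next
  case (Suc n)
  then obtain f' where *: "\<And>x. (f has_real_derivative f' x) (at x)" "bounded_derivs n f'"
    by auto
  have "\<forall>x. ((\<lambda>x. f (1 - x)) has_real_derivative (- 1) * f' (1 - x)) (at x)"
    by (intro allI DERIV_chain2[OF *(1), THEN DERIV_cong]) (auto intro!: derivative_eq_intros)
  moreover have "bounded_derivs n (\<lambda>x. (- 1) * f' (1 - x))"
    by (intro bounded_derivs_mult bounded_derivs_const Suc.IH *(2))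
  moreover have "bounded (range (\<lambda>x. f (1 - x)))"
    using Suc.prems by (auto simp: bounded_iff)
  ultimately show ?case
    by auto
qed

text \<open>The weight is a multiple of the product of \<open>flat_exp 0 x\<close> and \<open>flat_exp 0 (1 - x)\<close>.
The extra powers of \<open>1 / x\<close> make the family closed under differentiation.\<close>

definition flat_exp :: "nat \<Rightarrow> real \<Rightarrow> real" where
  "flat_exp n x = (if x > 0 then (1 / x) ^ n * exp (- 1 / x) else 0)"

lemma flat_exp_nonneg: "flat_exp n x \<ge> 0"
  by (simp add: flat_exp_def)

text \<open>With \<open>y = 1 / x\<close> this is the bound of \<open>y ^ n / fact n\<close> by the exponential series of \<open>y\<close>.\<close>

lemma flat_exp_le: "flat_exp n x \<le> fact n"
proof (cases "x > 0")
  case True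
  define y where "y = 1 / x"
  have "y > 0" using True by (simp add: y_def)
  have "y ^ n / fact n \<le> exp y"
  proof -
    have "y ^ n / fact n = (\<Sum>i\<in>{n}. y ^ i / fact i)" by simp
    also have "\<dots> \<le> (\<Sum>i. y ^ i / fact i)"
      using \<open>y > 0\<close> summable_exp[of y] by (intro sum_le_suminf) (auto simp: field_simps)
    also have "\<dots> = exp y"
      by (simp add: exp_def field_simps)
    finally show ?thesis .
  qed
  then have "y ^ n * exp (- y) \<le> fact n"
    by (simp add: exp_minus field_simps)
  then show ?thesis
    using True by (simp add: flat_exp_def y_def)
qed (simp add: flat_exp_def)

lemma bounded_flat_exp: "bounded (range (flat_exp n))"
  using flat_exp_nonneg[of n] flat_exp_le[of n] by (intro boundedI[of _ "fact n"]) auto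

text \<open>Boundedness of the next but one member of the family turns this into quadratic decay at the
origin, which is why the derivative exists there and vanishes.\<close>

lemma flat_exp_eq: "flat_exp n x = x\<^sup>2 * flat_exp (n + 2) x"
  by (simp add: flat_exp_def field_simps power2_eq_square)

lemma flat_exp_has_derivative:
  "(flat_exp n has_real_derivative (flat_exp (n + 2) x + (- real n) * flat_exp (n + 1) x)) (at x)"
proof -
  consider "x > 0" | "x < 0" | "x = 0" by linarith
  then show ?thesis
  proof cases
    case 1
    have "((\<lambda>x. 1 / x) has_real_derivative - (1 / x)\<^sup>2) (at x)"
      using 1 by (auto intro!: derivative_eq_intros simp: power2_eq_square)
    note deriv_pow = DERIV_power[OF this, of n]
    have "((\<lambda>x. exp (- 1 / x)) has_real_derivative exp (- 1 / x) * (1 / x)\<^sup>2) (at x)"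
      using 1 by (auto intro!: derivative_eq_intros simp: power2_eq_square)
    from DERIV_mult[OF deriv_pow this]
    have "((\<lambda>x. (1 / x) ^ n * exp (- 1 / x)) has_real_derivative
            (flat_exp (n + 2) x + (- real n) * flat_exp (n + 1) x)) (at x)"
      by (rule DERIV_cong)
         (use 1 in \<open>cases n; simp add: flat_exp_def power2_eq_square power_one_over field_simps\<close>)
    then show ?thesis
      by (rule has_field_derivative_transform_within_open[of _ _ _ "{0<..}"])
         (use 1 in \<open>auto simp: flat_exp_def\<close>)
  next
    case 2
    have "((\<lambda>x. 0) has_real_derivative (flat_exp (n + 2) x + (- real n) * flat_exp (n + 1) x)) (at x)"
      using 2 by (simp add: flat_exp_def)
    then show ?thesis
      by (rule has_field_derivative_transform_within_open[of _ _ _ "{..<0}"])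
         (use 2 in \<open>auto simp: flat_exp_def\<close>)
  next
    case 3
    have "((\<lambda>h. flat_exp n h / h) \<longlongrightarrow> 0) (at 0)"
    proof (rule Lim_null_comparison)
      show "\<forall>\<^sub>F h in at 0. norm (flat_exp n h / h) \<le> fact (n + 2) * \<bar>h\<bar>"
      proof (intro always_eventually allI)
        fix h :: real
        have "\<bar>flat_exp n h / h\<bar> = \<bar>h\<bar> * flat_exp (n + 2) h"
          unfolding flat_exp_eq[of n h] using flat_exp_nonneg[of "n + 2" h]
          by (simp add: power2_eq_square abs_mult)
        also have "\<dots> \<le> \<bar>h\<bar> * fact (n + 2)"
          by (intro mult_left_mono flat_exp_le) auto
        finally show "norm (flat_exp n h / h) \<le> fact (n + 2) * \<bar>h\<bar>"
          by (simp add: mult.commute)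
      qed
      show "((\<lambda>h. fact (n + 2) * \<bar>h\<bar>) \<longlongrightarrow> 0) (at (0::real))"
        by (auto intro!: tendsto_eq_intros)
    qed
    then show ?thesis
      using 3 by (simp add: DERIV_def flat_exp_def)
  qed
qed

lemma bounded_derivs_flat_exp: "bounded_derivs m (flat_exp n)"
proof (induction m arbitrary: n)
  case 0
  show ?case by (simp add: bounded_flat_exp)
next
  case (Suc m)
  have "bounded_derivs m (\<lambda>x. flat_exp (n + 2) x + (- real n) * flat_exp (n + 1) x)"
    by (intro bounded_derivs_add bounded_derivs_mult bounded_derivs_const Suc.IH)
  then show ?case
    using flat_exp_has_derivative[of n] bounded_flat_exp[of n] unfolding bounded_derivs.simps(2)
    by (intro conjI exI[of _ "\<lambda>x. flat_exp (n + 2) x + (- real n) * flat_exp (n + 1) x"] allI)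
qed

section \<open>The weight function\<close>

definition bump_mass :: real where
  "bump_mass = (LINT t:{0<..<1}|lborel. exp (- (inverse t * inverse (1 - t))))"

text \<open>By partial fractions, \<open>1 / (x (1 - x)) = 1 / x + 1 / (1 - x)\<close>.\<close>

lemma bump_eq:
  assumes "x \<in> {0<..<1}"
  shows "exp (- (inverse x * inverse (1 - x))) = flat_exp 0 x * flat_exp 0 (1 - x)"
proof -
  have "inverse x * inverse (1 - x) = 1 / x + 1 / (1 - x)"
    using assms by (simp add: field_simps)
  then show ?thesis
    using assms by (simp add: flat_exp_def exp_add[symmetric])
qed

lemma weight_eq: "weight x = inverse bump_mass * (flat_exp 0 x * flat_exp 0 (1 - x))"
proof (cases "x \<in> {0<..<1}")
  case True
  then show ?thesis
    by (simp add: weight_def bump_mass_def bump_eq)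
qed (auto simp: weight_def flat_exp_def)

lemma bounded_derivs_weight: "bounded_derivs m weight"
  unfolding weight_eq[abs_def]
  by (intro bounded_derivs_mult bounded_derivs_const bounded_derivs_reflect bounded_derivs_flat_exp)

lemma continuous_weight: "continuous_on A weight"
proof -
  obtain w' where "\<And>x. (weight has_real_derivative w' x) (at x)"
    using bounded_derivs_weight[of 1] by auto
  then show ?thesis
    by (meson DERIV_isCont continuous_at_imp_continuous_on)
qed

lemma weight_measurable [measurable]: "weight \<in> borel_measurable borel"
  by (rule borel_measurable_continuous_onI) (rule continuous_weight)

lemma weight_outside: "x \<le> 0 \<or> x \<ge> 1 \<Longrightarrow> weight x = 0"
  by (auto simp: weight_def)

lemma set_integrable_bump:
  "set_integrable lborel {0<..<1::real} (\<lambda>t. exp (- (inverse t * inverse (1 - t))))"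
  unfolding set_integrable_def
  by (rule integrableI_bounded_set[of "{0<..<1}" _ _ 1])
     (auto simp: indicator_def intro!: AE_I2)

lemma bump_mass_pos: "bump_mass > 0"
proof -
  let ?f = "\<lambda>t::real. indicator {0<..<1} t *\<^sub>R exp (- (inverse t * inverse (1 - t)))"
  have "bump_mass \<ge> 0"
    unfolding bump_mass_def set_lebesgue_integral_def by (intro integral_nonneg_AE) auto
  moreover have "bump_mass \<noteq> 0"
  proof
    assume "bump_mass = 0"
    then have "AE t in lborel. ?f t = 0"
      using integral_nonneg_eq_0_iff_AE[of lborel ?f] set_integrable_bump
      by (auto simp: bump_mass_def set_lebesgue_integral_def set_integrable_def)
    then have "AE t in lborel. t \<notin> {0<..<1::real}"
      by eventually_elim (auto simp: indicator_def split: if_splits)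
    then have "{0<..<1::real} \<in> null_sets lborel"
      by (simp add: AE_iff_null_sets)
    then show False
      by (auto simp: null_sets_def)
  qed
  ultimately show ?thesis by simp
qed

lemma weight_pos: "0 < x \<Longrightarrow> x < 1 \<Longrightarrow> weight x > 0"
  using bump_mass_pos by (simp add: weight_eq flat_exp_def)

lemma weight_nonneg: "weight x \<ge> 0"
  using weight_pos[of x] weight_outside[of x] by force

lemma integrable_weight: "integrable lborel weight"
proof -
  have "set_integrable lborel {0<..<1} (\<lambda>x. exp (- (inverse x * inverse (1 - x))) * inverse bump_mass)"
    by (intro set_integrable_mult_left set_integrable_bump)
  moreover have "(\<lambda>x. indicator {0<..<1} x *\<^sub>R (exp (- (inverse x * inverse (1 - x))) * inverse bump_mass)) = weight"
    by (auto simp: weight_def bump_mass_def indicator_def)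
  ultimately show ?thesis
    by (simp add: set_integrable_def)
qed

lemma integral_weight: "(LINT x|lborel. weight x) = 1"
proof -
  have "weight = (\<lambda>x. indicator {0<..<1} x *\<^sub>R (exp (- (inverse x * inverse (1 - x)))) * inverse bump_mass)"
    by (auto simp: weight_def bump_mass_def indicator_def)
  then have "(LINT x|lborel. weight x) =
      (LINT x|lborel. indicator {0<..<1} x *\<^sub>R (exp (- (inverse x * inverse (1 - x)))) * inverse bump_mass)"
    by metis
  also have "\<dots> = bump_mass * inverse bump_mass"
    by (simp only: bump_mass_def set_lebesgue_integral_def integral_mult_left_zero)
  finally show ?thesis
    using bump_mass_pos by simp
qed

section \<open>Iterated finite differences\<close>

definition fdiff :: "real \<Rightarrow> (real \<Rightarrow> 'a::ab_group_add) \<Rightarrow> real \<Rightarrow> 'a" where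
  "fdiff h f x = f (x + h) - f x"

lemma fdiff_funpow_derivative:
  assumes "\<And>x. (f has_real_derivative f' x) (at x)"
  shows "((fdiff h ^^ n) f has_real_derivative (fdiff h ^^ n) f' x) (at x)"
proof (induction n arbitrary: x)
  case (Suc n)
  show ?case
    using DERIV_diff[OF DERIV_shift[THEN iffD1, OF Suc.IH[of "x + h"]] Suc.IH[of x]]
    by (simp add: fdiff_def)
qed (use assms in simp)

text \<open>By the mean value theorem a difference of \<open>f\<close> is \<open>h\<close> times a value of its derivative, so each
of the \<open>n\<close> differences contributes a factor \<open>h\<close> and uses up one bounded derivative.\<close>

lemma fdiff_funpow_bound:
  assumes "bounded_derivs n f"
  shows "\<exists>B\<ge>0. \<forall>h\<ge>0. \<forall>x. \<bar>(fdiff h ^^ n) f x\<bar> \<le> B * h ^ n"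
  using assms
proof (induction n arbitrary: f)
  case 0
  then obtain B where "\<And>x. \<bar>f x\<bar> \<le> B" by (auto simp: bounded_iff)
  then show ?case
    by (intro exI[of _ B]) (auto intro: order_trans[OF abs_ge_zero])
next
  case (Suc n)
  then obtain f' where f': "\<And>x. (f has_real_derivative f' x) (at x)" "bounded_derivs n f'"
    by auto
  then obtain B where B: "B \<ge> 0" "\<And>h x. h \<ge> 0 \<Longrightarrow> \<bar>(fdiff h ^^ n) f' x\<bar> \<le> B * h ^ n"
    using Suc.IH by blast
  have "\<bar>(fdiff h ^^ Suc n) f x\<bar> \<le> B * h ^ Suc n" if "h \<ge> 0" for h x
  proof (cases "h = 0")
    case True
    then show ?thesis by (simp add: fdiff_def)
  next
    case False
    then have "x < x + h" using that by simp
    then obtain z where "(fdiff h ^^ n) f (x + h) - (fdiff h ^^ n) f x = (x + h - x) * (fdiff h ^^ n) f' z"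
      using MVT2[of x "x + h" "(fdiff h ^^ n) f" "(fdiff h ^^ n) f'"] fdiff_funpow_derivative[OF f'(1)]
      by blast
    then have "(fdiff h ^^ Suc n) f x = h * (fdiff h ^^ n) f' z"
      by (simp add: fdiff_def)
    then have "\<bar>(fdiff h ^^ Suc n) f x\<bar> = h * \<bar>(fdiff h ^^ n) f' z\<bar>"
      using that by (simp add: abs_mult)
    also have "\<dots> \<le> h * (B * h ^ n)"
      using that B by (intro mult_left_mono) auto
    finally show ?thesis by (simp add: ac_simps)
  qed
  then show ?case using B(1) by blast
qed

text \<open>The iterated difference at \<open>x\<close> only sees the values of \<open>f\<close> at \<open>x, x + h, \<dots>, x + n h\<close>, so the
support of \<open>f\<close> grows by \<open>n h\<close> on the left only.\<close>

lemma fdiff_funpow_outside: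
  fixes f :: "real \<Rightarrow> 'a::ab_group_add"
  assumes "h \<ge> 0" "\<And>x. x \<le> 0 \<or> x \<ge> 1 \<Longrightarrow> f x = 0"
  shows "x \<le> - real n * h \<or> x \<ge> 1 \<Longrightarrow> (fdiff h ^^ n) f x = 0"
proof (induction n arbitrary: x)
  case (Suc n)
  have "x + h \<le> - real n * h \<or> x + h \<ge> 1" "x \<le> - real n * h \<or> x \<ge> 1"
    using Suc.prems assms(1) by (auto simp: algebra_simps)
  then show ?case
    using Suc.IH by (simp add: fdiff_def)
qed (use assms in simp)

section \<open>Weighted averages of characters\<close>

text \<open>The constant is far from optimal; it comes from the cubic Taylor estimate, and only its
positivity matters for the lower bound on the distance between a character value and 1.\<close>

lemma sin_ge_quarter:
  assumes "0 \<le> y" "y \<le> pi / 2"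
  shows "y / 4 \<le> sin y"
proof -
  have "\<bar>sin y - (\<Sum>k<3. sin_coeff k * y ^ k)\<bar> \<le> inverse (fact 3) * \<bar>y\<bar> ^ 3"
    by (rule Maclaurin_sin_bound)
  moreover have "(\<Sum>k<3. sin_coeff k * y ^ k) = y"
    by (simp add: eval_nat_numeral sin_coeff_def)
  moreover have "\<bar>y\<bar> ^ 3 \<le> 4 * y"
  proof -
    have "y * (y * y) \<le> y * (2 * 2)"
      using assms pi_less_4 by (intro mult_left_mono mult_mono) auto
    then show ?thesis
      using assms by (simp add: power3_eq_cube)
  qed
  ultimately have "\<bar>sin y - y\<bar> \<le> 4 * y / 6"
    using assms by (simp add: fact_numeral)
  then show ?thesis
    using assms(1) by linarith
qed

text \<open>The Diophantine condition controls the distance of a frequency to the integers, whereas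
summation by parts divides by \<open>cis (2 * pi * t) - 1\<close>. The former is bounded by the latter.\<close>

lemma norm_cis_minus_one_ge:
  "\<bar>t - real_of_int (round t)\<bar> \<le> norm (cis (2 * pi * t) - 1)"
proof -
  define u where "u = t - real_of_int (round t)"
  have u: "\<bar>u\<bar> \<le> 1 / 2"
    using of_int_round_abs_le[of t] by (simp add: u_def abs_minus_commute)
  have "2 * pi * t = 2 * pi * u + 2 * pi * real_of_int (round t)"
    by (simp add: u_def algebra_simps)
  then have "cis (2 * pi * t) = cis (2 * pi * u) * cis (2 * pi * real_of_int (round t))"
    by (simp only: cis_mult)
  also have "cis (2 * pi * real_of_int (round t)) = 1"
    by (rule cis_multiple_2pi) auto
  finally have "cis (2 * pi * t) = exp (\<i> * of_real (2 * pi * u))"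
    by (simp add: cis_conv_exp)
  then have "norm (cis (2 * pi * t) - 1) = 2 * \<bar>sin (pi * u)\<bar>"
    by (simp only: dist_exp_i_1) simp
  also have "\<bar>sin (pi * u)\<bar> = \<bar>sin (pi * \<bar>u\<bar>)\<bar>"
    by (cases "u \<ge> 0") auto
  also have "2 * \<dots> \<ge> 2 * (pi * \<bar>u\<bar> / 4)"
    using u by (intro mult_left_mono order_trans[OF sin_ge_quarter abs_ge_self]) auto
  also have "2 * (pi * \<bar>u\<bar> / 4) \<ge> \<bar>u\<bar>"
    using pi_ge_two mult_right_mono[of 2 pi "\<bar>u\<bar>"] by simp
  finally show ?thesis
    by (simp add: u_def)
qed

lemma sum_Suc_diff_mult_power:
  fixes g :: "nat \<Rightarrow> 'a::comm_ring_1"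
  shows "z * (\<Sum>n<L. (g (Suc n) - g n) * z ^ n) = (1 - z) * (\<Sum>n<L. g n * z ^ n) + z ^ L * g L - g 0"
  by (induction L) (simp_all add: algebra_simps)

lemma sum_lessThan_add_split:
  fixes f :: "nat \<Rightarrow> 'a::comm_monoid_add"
  shows "(\<Sum>n<m + N. f n) = (\<Sum>n<m. f n) + (\<Sum>n<N. f (m + n))"
  by (induction N) (simp_all add: add.assoc)

text \<open>Summation by parts \<open>m\<close> times trades the factor \<open>(1 - z) ^ m\<close> for an \<open>m\<close>-th difference of the
weight with step \<open>1 / N\<close>, which is of size \<open>N ^ -m\<close>. There are no boundary terms because the weight vanishes
outside the unit interval.\<close>

lemma weighted_exponential_sum_bound:
  "\<exists>C\<ge>0. \<forall>N\<ge>1. \<forall>z. norm z = 1 \<longrightarrow>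
     norm (1 - z) ^ m * norm (\<Sum>n<N. complex_of_real (weight (real n / real N)) * z ^ n)
       \<le> C * real N / real N ^ m"
proof -
  obtain B where B: "B \<ge> 0" "\<And>h x. h \<ge> 0 \<Longrightarrow> \<bar>(fdiff h ^^ m) weight x\<bar> \<le> B * h ^ m"
    using fdiff_funpow_bound[OF bounded_derivs_weight] by metis
  have "norm (1 - z) ^ m * norm (\<Sum>n<N. complex_of_real (weight (real n / real N)) * z ^ n)
       \<le> ((1 + real m) * B) * real N / real N ^ m"
    if N: "N \<ge> 1" and z: "norm z = 1" for N z
  proof -
    define h where "h = 1 / real N"
    have h: "h > 0" "real N * h = 1" using N by (auto simp: h_def)
    \<comment> \<open>The grid starts at \<open>- m / N\<close>, so that all differences up to order \<open>m\<close> vanish at its left end.\<close>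
    define G where "G i n = complex_of_real ((fdiff h ^^ i) weight (real n * h - real m * h))" for i n
    have G_Suc: "G (Suc i) n = G i (Suc n) - G i n" for i n
      by (simp add: G_def fdiff_def algebra_simps)
    have G_left: "G i n = 0" if "n + i \<le> m" for i n
    proof -
      have "real n * h + real i * h \<le> real m * h"
        using that h(1) by (simp add: mult_right_mono flip: distrib_right of_nat_add)
      then show ?thesis
        using fdiff_funpow_outside[of h weight "real n * h - real m * h" i] weight_outside h(1)
        by (simp add: G_def)
    qed
    have G_right: "G i (m + N) = 0" for i
      using fdiff_funpow_outside[of h weight "real (m + N) * h - real m * h" i] weight_outside h
      by (simp add: G_def algebra_simps)
    have *: "z ^ i * (\<Sum>n<m + N. G i n * z ^ n) = (1 - z) ^ i * (\<Sum>n<m + N. G 0 n * z ^ n)"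
      if "i \<le> m" for i
      using that
    proof (induction i)
      case (Suc i)
      have "z * (\<Sum>n<m + N. G (Suc i) n * z ^ n) = (1 - z) * (\<Sum>n<m + N. G i n * z ^ n)"
        unfolding G_Suc sum_Suc_diff_mult_power using Suc.prems by (simp add: G_right G_left)
      then have "z ^ Suc i * (\<Sum>n<m + N. G (Suc i) n * z ^ n)
          = (1 - z) * (z ^ i * (\<Sum>n<m + N. G i n * z ^ n))"
        by (simp add: ac_simps)
      then show ?case
        using Suc by simp
    qed auto
    have "(\<Sum>n<m + N. G 0 n * z ^ n) =
        z ^ m * (\<Sum>n<N. complex_of_real (weight (real n / real N)) * z ^ n)"
    proof -
      have "G 0 (m + n) = complex_of_real (weight (real n / real N))" for n
        by (simp add: G_def h_def algebra_simps add_divide_distrib)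
      then show ?thesis
        unfolding sum_lessThan_add_split
        by (simp add: G_left sum_distrib_left power_add mult.assoc mult.left_commute mult.commute)
    qed
    then have "norm (1 - z) ^ m * norm (\<Sum>n<N. complex_of_real (weight (real n / real N)) * z ^ n)
        = norm ((1 - z) ^ m * (\<Sum>n<m + N. G 0 n * z ^ n))"
      using z by (simp add: norm_mult norm_power)
    also have "\<dots> = norm (\<Sum>n<m + N. G m n * z ^ n)"
      using z by (simp add: norm_mult norm_power flip: *)
    also have "\<dots> \<le> (\<Sum>n<m + N. B * h ^ m)"
      using z B(2)[of h] h(1) by (intro sum_norm_le) (auto simp: norm_mult norm_power G_def)
    also have "\<dots> = (real m + real N) * (B * h ^ m)"
      by simp
    also have "\<dots> \<le> ((1 + real m) * real N) * (B * h ^ m)"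
      using N B(1) h mult_left_mono[of 1 "real N" "real m"]
      by (intro mult_right_mono) (auto simp: algebra_simps)
    finally show ?thesis
      by (simp add: h_def power_one_over ac_simps)
  qed
  then show ?thesis
    using B(1) by (intro exI[of _ "(1 + real m) * B"]) auto
qed

text \<open>About a quarter of the sample points lie between 1/4 and 1/2, where the weight is bounded below by a
positive constant.\<close>

lemma sum_weight_ge:
  "\<exists>c>0. \<forall>N\<ge>4. c * real N \<le> (\<Sum>n<N. weight (real n / real N))"
proof -
  obtain x0 where x0: "x0 \<in> {1/4..1/2::real}" "\<And>x. x \<in> {1/4..1/2} \<Longrightarrow> weight x0 \<le> weight x"
    using continuous_attains_inf[of "{1/4..1/2::real}" weight] continuous_weight by auto
  have pos: "weight x0 > 0" using x0(1) by (intro weight_pos) auto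
  have "weight x0 / 8 * real N \<le> (\<Sum>n<N. weight (real n / real N))" if N: "N \<ge> 4" for N
  proof -
    let ?I = "{N div 4 + 1..N div 2}"
    have "real N / 8 \<le> real (card ?I)"
    proof -
      have "2 * (N div 4) \<le> N div 2" "1 \<le> N div 4" "N < 4 * (N div 4) + 4"
        using N by linarith+
      then have "N \<le> 8 * (N div 2 - N div 4)" by linarith
      then show ?thesis by simp
    qed
    then have "weight x0 / 8 * real N \<le> real (card ?I) * weight x0"
      using mult_right_mono[of "real N / 8" "real (card ?I)" "weight x0"] pos by (simp add: ac_simps)
    also have "\<dots> \<le> (\<Sum>n\<in>?I. weight (real n / real N))"
    proof (rule sum_bounded_below)
      fix n assume "n \<in> ?I"
      then have "N \<le> 4 * n" "2 * n \<le> N" by (simp_all, linarith+)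
      then have "real n / real N \<in> {1/4..1/2}" using N by (auto simp: field_simps)
      then show "weight x0 \<le> weight (real n / real N)" by (rule x0)
    qed
    also have "\<dots> \<le> (\<Sum>n<N. weight (real n / real N))"
      using N weight_nonneg by (intro sum_mono2) auto
    finally show ?thesis .
  qed
  then show ?thesis using pos by (intro exI[of _ "weight x0 / 8"]) auto
qed

lemma integrable_mult_cis:
  "integrable lborel f \<Longrightarrow> integrable lborel (\<lambda>x. complex_of_real (f x) * cis (b * x))"
  by (rule Bochner_Integration.integrable_bound[of _ f])
     (auto simp: norm_mult cis_conv_exp intro!: borel_measurable_times borel_measurable_of_real)

lemma integrable_fdiff:
  fixes f :: "real \<Rightarrow> real"
  assumes "integrable lborel f"
  shows "integrable lborel (fdiff h f)"
  using lborel_integrable_real_affine[OF assms, of 1 h] assms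
  by (simp add: fdiff_def[abs_def] add.commute)

text \<open>A translation by half a period \<open>h\<close> changes the sign of the Fourier integral.\<close>

lemma fourier_fdiff:
  assumes f: "integrable lborel f" and h: "cis (b * h) = - 1"
  shows "(LINT x|lborel. complex_of_real (fdiff h f x) * cis (b * x))
       = - 2 * (LINT x|lborel. complex_of_real (f x) * cis (b * x))"
proof -
  have "(LINT x|lborel. complex_of_real (f x) * cis (b * x))
      = (LINT x|lborel. complex_of_real (f (h + x)) * cis (b * (h + x)))"
    using lborel_integral_real_affine[of 1 "\<lambda>x. complex_of_real (f x) * cis (b * x)" h] by simp
  also have "\<dots> = - (LINT x|lborel. complex_of_real (f (x + h)) * cis (b * x))"
    using h by (simp add: distrib_left flip: cis_mult) (simp add: add.commute)
  finally have *: "(LINT x|lborel. complex_of_real (f (x + h)) * cis (b * x))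
      = - (LINT x|lborel. complex_of_real (f x) * cis (b * x))" by simp
  have "integrable lborel (\<lambda>x. f (x + h))"
    using lborel_integrable_real_affine[OF f, of 1 h] by (simp add: add.commute)
  then show ?thesis
    using integrable_mult_cis[OF f, of b] integrable_mult_cis[of "\<lambda>x. f (x + h)" b] *
    by (simp add: fdiff_def left_diff_distrib)
qed

text \<open>The continuous counterpart of summation by parts: taking \<open>m\<close> differences with step
\<open>pi / \<bar>b\<bar>\<close> multiplies the integral by \<open>(- 2) ^ m\<close>, while the integrand becomes of size \<open>\<bar>b\<bar> ^ -m\<close>.\<close>

lemma weight_fourier_bound:
  "\<exists>C\<ge>0. \<forall>b. b \<noteq> 0 \<longrightarrow>
     \<bar>b\<bar> ^ m * norm (LINT x|lborel. complex_of_real (weight x) * cis (b * x)) \<le> C"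
proof -
  obtain B where B: "B \<ge> 0" "\<And>h x. h \<ge> 0 \<Longrightarrow> \<bar>(fdiff h ^^ m) weight x\<bar> \<le> B * h ^ m"
    using fdiff_funpow_bound[OF bounded_derivs_weight] by metis
  define C where "C = B * pi ^ m * (1 + real m * pi) + 1"
  have C: "C \<ge> 1" using B(1) by (simp add: C_def)
  have "\<bar>b\<bar> ^ m * norm (LINT x|lborel. complex_of_real (weight x) * cis (b * x)) \<le> C"
    if b: "b \<noteq> 0" for b
  \<comment> \<open>For small \<open>b\<close> the differences would spread the weight over a long interval, but then the
    total mass 1 of the weight is already a sufficient bound.\<close>
  proof (cases "\<bar>b\<bar> < 1")
    case True
    have "norm (LINT x|lborel. complex_of_real (weight x) * cis (b * x))
        \<le> (LINT x|lborel. norm (complex_of_real (weight x) * cis (b * x)))"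
      by (rule integral_norm_bound)
    also have "\<dots> = 1"
      using weight_nonneg by (simp add: norm_mult integral_weight)
    finally have "\<bar>b\<bar> ^ m * norm (LINT x|lborel. complex_of_real (weight x) * cis (b * x)) \<le> 1 * 1"
      using True by (intro mult_mono power_le_one) auto
    then show ?thesis using C by simp
  next
    case False
    define h where "h = pi / \<bar>b\<bar>"
    have h: "0 < h" "h \<le> pi"
      using False b by (auto simp: h_def field_simps)
    have cis_h: "cis (b * h) = - 1"
      using b by (cases "b > 0") (auto simp: h_def complex_eq_iff)
    define g where "g i = (fdiff h ^^ i) weight" for i
    have g_int: "integrable lborel (g i)" for i
      by (induction i) (auto simp: g_def integrable_weight integrable_fdiff)
    have rec: "(LINT x|lborel. complex_of_real (g i x) * cis (b * x))
      = (- 2) ^ i * (LINT x|lborel. complex_of_real (weight x) * cis (b * x))" for i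
    proof (induction i)
      case (Suc i)
      then show ?case
        using fourier_fdiff[OF g_int cis_h, of i] by (simp add: g_def)
    qed (simp add: g_def)
    let ?K = "{- real m * h..1}"
    have mh: "- 1 \<le> real m * h"
      by (rule order_trans[of _ 0]) (use h in auto)
    have "norm (LINT x|lborel. complex_of_real (weight x) * cis (b * x))
        \<le> 2 ^ m * norm (LINT x|lborel. complex_of_real (weight x) * cis (b * x))"
      using mult_right_mono[of 1 "2 ^ m::real"] by simp
    also have "\<dots> = norm (LINT x|lborel. complex_of_real (g m x) * cis (b * x))"
      unfolding rec by (simp add: norm_mult norm_power)
    also have "\<dots> \<le> (LINT x|lborel. norm (complex_of_real (g m x) * cis (b * x)))"
      by (rule integral_norm_bound)
    also have "\<dots> = (LINT x|lborel. \<bar>g m x\<bar>)"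
      by (simp add: norm_mult)
    also have "\<dots> \<le> (LINT x|lborel. (B * h ^ m) * indicator ?K x)"
    proof (rule integral_mono)
      show "integrable lborel (\<lambda>x. B * h ^ m * indicator ?K x)"
        by (intro integrable_mult_right integrable_real_indicator) (auto simp: emeasure_lborel_Icc_eq)
      show "\<bar>g m x\<bar> \<le> B * h ^ m * indicator ?K x" for x
        using B(2)[of h x] h fdiff_funpow_outside[of h weight x m] weight_outside
        by (auto simp: g_def indicator_def)
    qed (use g_int in auto)
    also have "\<dots> = B * h ^ m * (1 + real m * h)"
      using mh by simp
    also have "\<dots> \<le> B * h ^ m * (1 + real m * pi)"
      using h B(1) by (intro mult_left_mono add_left_mono) auto
    finally have "\<bar>b\<bar> ^ m * norm (LINT x|lborel. complex_of_real (weight x) * cis (b * x))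
        \<le> \<bar>b\<bar> ^ m * (B * h ^ m * (1 + real m * pi))"
      by (intro mult_left_mono) auto
    also have "\<dots> = B * (\<bar>b\<bar> * h) ^ m * (1 + real m * pi)"
      by (simp add: power_mult_distrib ac_simps)
    also have "\<bar>b\<bar> * h = pi"
      using b by (simp add: h_def)
    finally show ?thesis by (simp add: C_def)
  qed
  then show ?thesis using C by (intro exI[of _ C]) auto
qed

lemma weight_rescaled_fourier:
  assumes T: "T > 0"
  shows "1 / complex_of_real T * (LINT s:{0..T}|lborel. complex_of_real (weight (s / T)) * cis (2 * pi * (s * a)))
    = (LINT x|lborel. complex_of_real (weight x) * cis (2 * pi * T * a * x))"
proof -
  have "(LINT s:{0..T}|lborel. complex_of_real (weight (s / T)) * cis (2 * pi * (s * a)))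
      = (LINT s|lborel. complex_of_real (weight (s / T)) * cis (2 * pi * (s * a)))"
    unfolding set_lebesgue_integral_def
  proof (intro Bochner_Integration.integral_cong refl)
    fix s
    have "weight (s / T) = 0" if "s \<notin> {0..T}"
      using weight_outside[of "s / T"] that T by (auto simp: field_simps)
    then show "indicator {0..T} s *\<^sub>R (complex_of_real (weight (s / T)) * cis (2 * pi * (s * a)))
        = complex_of_real (weight (s / T)) * cis (2 * pi * (s * a))"
      by (auto simp: indicator_def)
  qed
  also have "\<dots> = \<bar>T\<bar> *\<^sub>R (LINT x|lborel. complex_of_real (weight ((0 + T * x) / T)) * cis (2 * pi * ((0 + T * x) * a)))"
    by (rule lborel_integral_real_affine) (use T in auto)
  also have "\<dots> = T * (LINT x|lborel. complex_of_real (weight x) * cis (2 * pi * T * a * x))"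
    using T by (simp add: scaleR_conv_of_real ac_simps)
  finally show ?thesis using T by simp
qed

lemma integrable_weight_rescaled: "T > 0 \<Longrightarrow> integrable lborel (\<lambda>s. weight (s / T))"
  using lborel_integrable_real_affine[OF integrable_weight, of "1 / T" 0] by simp


section \<open>Exchanging sums with integrals and products\<close>

lemma has_sum_tail_bound:
  fixes f :: "'k \<Rightarrow> 'b::banach"
  assumes "(f has_sum s) A" "(a has_sum t) A" "\<And>k. k \<in> A \<Longrightarrow> norm (f k) \<le> a k"
    and "X \<subseteq> A" "finite X"
  shows "norm (s - sum f X) \<le> t - sum a X"
proof -
  have f: "(f has_sum (s - sum f X)) (A - X)" and a: "(a has_sum (t - sum a X)) (A - X)"
    using assms by (auto intro!: has_sum_Diff)
  have "(\<lambda>k. norm (f k)) summable_on (A - X)"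
    by (rule Infinite_Sum.abs_summable_on_comparison_test'[of a]) (use a assms in \<open>auto simp: summable_on_def\<close>)
  then have n: "((\<lambda>k. norm (f k)) has_sum infsum (\<lambda>k. norm (f k)) (A - X)) (A - X)"
    by (rule has_sum_infsum)
  have "norm (s - sum f X) \<le> infsum (\<lambda>k. norm (f k)) (A - X)"
    by (rule norm_has_sum_bound[OF n f])
  also have "\<dots> \<le> t - sum a X"
    by (rule has_sum_mono[OF n a]) (use assms in auto)
  finally show ?thesis .
qed

text \<open>This is dominated convergence for sums over an index set without an enumeration. The limit is
measurable as a pointwise limit along finite subsets that exhaust the sum of \<open>a\<close>.\<close>

lemma has_sum_integral_dominated:
  fixes f :: "'k \<Rightarrow> 'a \<Rightarrow> 'b::{banach, second_countable_topology}"
  assumes g: "integrable M g" and a: "(a has_sum t) A"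
    and f: "\<And>k. k \<in> A \<Longrightarrow> f k \<in> borel_measurable M"
    and le: "\<And>k x. k \<in> A \<Longrightarrow> x \<in> space M \<Longrightarrow> norm (f k x) \<le> a k * g x"
    and F: "\<And>x. x \<in> space M \<Longrightarrow> ((\<lambda>k. f k x) has_sum F x) A"
  shows "((\<lambda>k. LINT x|M. f k x) has_sum (LINT x|M. F x)) A"
proof -
  have tail: "norm (F x - (\<Sum>k\<in>X. f k x)) \<le> (t - sum a X) * g x"
    if "X \<subseteq> A" "finite X" "x \<in> space M" for X x
    using has_sum_tail_bound[OF F[OF that(3)] has_sum_cmult_left[OF a] le[OF _ that(3)] that(1,2)]
    by (simp add: left_diff_distrib sum_distrib_right)
  have a_lim: "(sum a \<longlongrightarrow> t) (finite_subsets_at_top A)"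
    using a by (simp add: has_sum_def)
  have "\<exists>X. finite X \<and> X \<subseteq> A \<and> dist (sum a X) t \<le> 1 / real (Suc n)" for n
    by (rule has_sum_finite_approximation[OF a]) auto
  then obtain X where X: "\<And>n. finite (X n)" "\<And>n. X n \<subseteq> A" "\<And>n. dist (sum a (X n)) t \<le> 1 / real (Suc n)"
    by metis
  have f_int: "integrable M (f k)" if "k \<in> A" for k
    by (rule Bochner_Integration.integrable_bound[of _ "\<lambda>x. a k * g x"])
       (use g f le that in \<open>auto intro!: AE_I2 order_trans[OF _ abs_ge_self]\<close>)
  have "(\<lambda>n. sum a (X n)) \<longlonglongrightarrow> t"
  proof (rule LIM_zero_cancel, rule Lim_null_comparison)
    show "\<forall>\<^sub>F n in sequentially. norm (sum a (X n) - t) \<le> 1 / real (Suc n)"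
      using X(3) by (auto simp: dist_norm)
    show "(\<lambda>n. 1 / real (Suc n)) \<longlonglongrightarrow> 0"
      using LIMSEQ_inverse_real_of_nat by (simp add: divide_inverse)
  qed
  then have null: "(\<lambda>n. t - sum a (X n)) \<longlonglongrightarrow> 0"
    using tendsto_diff[OF tendsto_const[of t]] by force
  have F_meas [measurable]: "F \<in> borel_measurable M"
  proof (rule borel_measurable_LIMSEQ_metric)
    show "(\<lambda>x. \<Sum>k\<in>X n. f k x) \<in> borel_measurable M" for n
      using f X(2) by (intro borel_measurable_sum) auto
    show "(\<lambda>n. \<Sum>k\<in>X n. f k x) \<longlonglongrightarrow> F x" if x: "x \<in> space M" for x
    proof (rule LIM_zero_cancel, rule Lim_null_comparison)
      show "\<forall>\<^sub>F n in sequentially. norm ((\<Sum>k\<in>X n. f k x) - F x) \<le> (t - sum a (X n)) * g x"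
        using tail[OF X(2,1) x] by (simp add: norm_minus_commute)
      show "(\<lambda>n. (t - sum a (X n)) * g x) \<longlonglongrightarrow> 0"
        using tendsto_mult_left_zero[OF null] by simp
    qed
  qed
  have F_int: "integrable M F"
    by (rule Bochner_Integration.integrable_bound[of _ "\<lambda>x. t * g x"])
       (use g tail[of "{}"] in \<open>auto intro!: AE_I2 order_trans[OF _ abs_ge_self]\<close>)
  have "((\<lambda>Y. \<Sum>k\<in>Y. LINT x|M. f k x) \<longlongrightarrow> (LINT x|M. F x)) (finite_subsets_at_top A)"
  proof (rule LIM_zero_cancel, rule Lim_null_comparison)
    show "\<forall>\<^sub>F Y in finite_subsets_at_top A.
        norm ((\<Sum>k\<in>Y. LINT x|M. f k x) - (LINT x|M. F x)) \<le> (t - sum a Y) * (LINT x|M. g x)"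
    proof (rule eventually_finite_subsets_at_top_weakI)
      fix Y assume Y: "finite Y" "Y \<subseteq> A"
      have Y_int: "integrable M (\<lambda>x. \<Sum>k\<in>Y. f k x)"
        using Y f_int by auto
      have "(LINT x|M. F x) - (\<Sum>k\<in>Y. LINT x|M. f k x) = (LINT x|M. F x - (\<Sum>k\<in>Y. f k x))"
        using Y f_int F_int Y_int by (subst Bochner_Integration.integral_diff)
          (auto simp: Bochner_Integration.integral_sum subset_iff)
      also have "norm \<dots> \<le> (LINT x|M. (t - sum a Y) * g x)"
        by (rule order_trans[OF integral_norm_bound integral_mono])
           (use g F_int Y_int tail[OF Y(2,1)] in auto)
      finally show "norm ((\<Sum>k\<in>Y. LINT x|M. f k x) - (LINT x|M. F x)) \<le> (t - sum a Y) * (LINT x|M. g x)"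
        by (simp add: norm_minus_commute)
    qed
    have "((\<lambda>Y. t - sum a Y) \<longlongrightarrow> t - t) (finite_subsets_at_top A)"
      by (intro tendsto_intros a_lim)
    then show "((\<lambda>Y. (t - sum a Y) * (LINT x|M. g x)) \<longlongrightarrow> 0) (finite_subsets_at_top A)"
      using tendsto_mult_left_zero by force
  qed
  then show ?thesis by (simp add: has_sum_def)
qed

text \<open>A finite set of functions lies in the product of its coordinate projections, so its sum is at most
the product of the coordinate sums.\<close>

lemma summable_on_prod_PiE:
  fixes f :: "'i \<Rightarrow> 'k \<Rightarrow> real"
  assumes I: "finite I" and nonneg: "\<And>i k. i \<in> I \<Longrightarrow> k \<in> B i \<Longrightarrow> 0 \<le> f i k"
    and sm: "\<And>i. i \<in> I \<Longrightarrow> f i summable_on B i"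
  shows "(\<lambda>g. \<Prod>i\<in>I. f i (g i)) summable_on PiE I B"
proof (rule nonneg_bdd_above_summable_on)
  show "0 \<le> (\<Prod>i\<in>I. f i (g i))" if "g \<in> PiE I B" for g
    using that nonneg by (auto intro!: prod_nonneg)
  show "bdd_above (sum (\<lambda>g. \<Prod>i\<in>I. f i (g i)) ` {F. F \<subseteq> PiE I B \<and> finite F})"
  proof (rule bdd_aboveI2)
    fix F assume F: "F \<in> {F. F \<subseteq> PiE I B \<and> finite F}"
    define C where "C i = (\<lambda>g. g i) ` F" for i
    have C: "finite (C i)" "i \<in> I \<Longrightarrow> C i \<subseteq> B i" for i
      using F by (auto simp: C_def)
    have "sum (\<lambda>g. \<Prod>i\<in>I. f i (g i)) F \<le> sum (\<lambda>g. \<Prod>i\<in>I. f i (g i)) (PiE I C)"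
    proof (rule sum_mono2)
      show "F \<subseteq> PiE I C"
        using F by (auto simp: C_def PiE_iff subset_iff)
      show "0 \<le> (\<Prod>i\<in>I. f i (g i))" if "g \<in> PiE I C - F" for g
        using that nonneg C by (intro prod_nonneg) (auto simp: PiE_iff subset_iff)
    qed (use I C in \<open>auto intro!: finite_PiE\<close>)
    also have "\<dots> = (\<Prod>i\<in>I. sum (f i) (C i))"
      using I C by (simp add: prod_sum_PiE)
    also have "\<dots> \<le> (\<Prod>i\<in>I. infsum (f i) (B i))"
      using C nonneg sm
      by (intro prod_mono) (fastforce intro!: sum_nonneg finite_sum_le_infsum simp: subset_iff)
    finally show "sum (\<lambda>g. \<Prod>i\<in>I. f i (g i)) F \<le> (\<Prod>i\<in>I. infsum (f i) (B i))" .
  qed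
qed

lemma has_sum_prod_PiE:
  fixes f :: "'i \<Rightarrow> 'k \<Rightarrow> complex"
  assumes I: "finite I" and sm: "\<And>i. i \<in> I \<Longrightarrow> (\<lambda>k. norm (f i k)) summable_on B i"
    and s: "\<And>i. i \<in> I \<Longrightarrow> (f i has_sum s i) (B i)"
  shows "((\<lambda>g. \<Prod>i\<in>I. f i (g i)) has_sum (\<Prod>i\<in>I. s i)) (PiE I B)"
proof -
  have "(\<lambda>g. \<Prod>i\<in>I. norm (f i (g i))) summable_on PiE I B"
    by (rule summable_on_prod_PiE) (use I sm in auto)
  then have "(\<lambda>g. norm (\<Prod>i\<in>I. f i (g i))) summable_on PiE I B"
    by (simp add: prod_norm)
  then have "((\<lambda>g. \<Prod>i\<in>I. f i (g i)) has_sum infsum (\<lambda>g. \<Prod>i\<in>I. f i (g i)) (PiE I B)) (PiE I B)"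
    by (rule has_sum_infsum[OF Infinite_Sum.abs_summable_summable])
  also have "infsum (\<lambda>g. \<Prod>i\<in>I. f i (g i)) (PiE I B) = (\<Prod>i\<in>I. infsum (f i) (B i))"
    by (rule infsum_prod_PiE_abs[OF I sm])
  also have "\<dots> = (\<Prod>i\<in>I. s i)"
    using s by (intro prod.cong refl) (auto dest: infsumI)
  finally show ?thesis .
qed

lemma has_sum_sum_finite:
  fixes f :: "'i \<Rightarrow> 'k \<Rightarrow> complex"
  assumes "finite I" "\<And>i. i \<in> I \<Longrightarrow> (f i has_sum s i) A"
  shows "((\<lambda>k. \<Sum>i\<in>I. f i k) has_sum (\<Sum>i\<in>I. s i)) A"
  using assms by (induction I rule: finite_induct) (auto intro!: has_sum_add)


section \<open>Fourier series on the infinite torus\<close>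

lemma jbracket_ge_1: "jbracket j \<ge> 1"
  by (simp add: jbracket_def)

text \<open>The terms of a convergent series tend to 0, and a nonzero integer has absolute value at least 1.\<close>

lemma finite_support_int_vecs:
  assumes "k \<in> int_vecs \<eta>"
  shows "finite {j. k j \<noteq> 0}"
proof -
  have "(\<lambda>j. jbracket j ^ \<eta> * \<bar>real_of_int (k j)\<bar>) \<longlonglongrightarrow> 0"
    using assms by (intro summable_LIMSEQ_zero) (simp add: int_vecs_def)
  then have "\<forall>\<^sub>F j in sequentially. jbracket j ^ \<eta> * \<bar>real_of_int (k j)\<bar> < 1"
    by (auto dest: order_tendstoD(2)[of _ _ _ 1])
  then have "\<forall>\<^sub>F j in sequentially. k j = 0"
  proof eventually_elim
    case (elim j)
    have "1 * \<bar>real_of_int (k j)\<bar> \<le> jbracket j ^ \<eta> * \<bar>real_of_int (k j)\<bar>"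
      by (intro mult_right_mono one_le_power jbracket_ge_1) auto
    with elim have "real_of_int \<bar>k j\<bar> < real_of_int 1" by simp
    then show ?case by (simp only: of_int_less_iff)
  qed
  then obtain n where "\<And>j. j \<ge> n \<Longrightarrow> k j = 0"
    by (auto simp: eventually_sequentially)
  then have "{j. k j \<noteq> 0} \<subseteq> {..<n}"
    by (auto simp: not_less[symmetric])
  then show ?thesis
    by (rule finite_subset) auto
qed

lemma int_dot_finite:
  assumes "k \<in> int_vecs \<eta>"
  shows "int_dot k x = (\<Sum>j | k j \<noteq> 0. of_int (k j) * x j)"
  unfolding int_dot_def by (rule suminf_finite) (use finite_support_int_vecs[OF assms] in auto)

lemma eta_norm_nonneg: "k \<in> int_vecs \<eta> \<Longrightarrow> eta_norm \<eta> k \<ge> 0"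
  unfolding eta_norm_def int_vecs_def by (intro suminf_nonneg) (auto simp: jbracket_def)

lemma zero_in_int_vecs: "(\<lambda>_. 0) \<in> int_vecs \<eta>"
  by (simp add: int_vecs_def)

lemma exp_int_dot_of_real:
  assumes "k \<in> int_vecs \<eta>"
  shows "exp (2 * of_real pi * \<i> * int_dot k (\<lambda>j. complex_of_real (x j))) = cis (2 * pi * int_dot k x)"
  by (simp add: int_dot_finite[OF assms] cis_conv_exp ac_simps)

text \<open>Reducing the coordinates modulo 1 changes the phase by an integer. This is where finiteness of the
support of \<open>k\<close> enters: only finitely many integer parts are added.\<close>

lemma cis_int_dot_torus_rot:
  assumes "k \<in> int_vecs \<eta>"
  shows "cis (2 * pi * int_dot k (torus_rot \<rho> s \<theta>))
       = cis (2 * pi * int_dot k \<theta>) * cis (2 * pi * (s * int_dot k \<rho>))"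
proof -
  define n where "n = (\<Sum>j | k j \<noteq> 0. k j * \<lfloor>\<theta> j + s * \<rho> j\<rfloor>)"
  have "int_dot k (torus_rot \<rho> s \<theta>) = int_dot k \<theta> + s * int_dot k \<rho> - of_int n"
    by (simp add: int_dot_finite[OF assms] torus_rot_def frac_def n_def algebra_simps
        sum.distrib sum_subtractf sum_distrib_left)
  then have "2 * pi * int_dot k (torus_rot \<rho> s \<theta>) =
      2 * pi * int_dot k \<theta> + 2 * pi * (s * int_dot k \<rho>) + 2 * pi * of_int (- n)"
    by (simp only: of_int_minus) (simp add: algebra_simps)
  then have "cis (2 * pi * int_dot k (torus_rot \<rho> s \<theta>)) =
      cis (2 * pi * int_dot k \<theta> + 2 * pi * (s * int_dot k \<rho>) + 2 * pi * of_int (- n))"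
    by (rule arg_cong)
  also have "\<dots> = cis (2 * pi * int_dot k \<theta> + 2 * pi * (s * int_dot k \<rho>)) * cis (2 * pi * of_int (- n))"
    by (simp only: cis_mult)
  also have "cis (2 * pi * of_int (- n)) = 1"
    by (rule cis_multiple_2pi) auto
  finally show ?thesis by (simp add: cis_mult)
qed

lemma torus_rot_in_torus: "torus_rot \<rho> s \<theta> \<in> torus"
  by (simp add: torus_def torus_rot_def frac_lt_1)

lemma analytic_space_fourier:
  assumes "u \<in> analytic_space \<eta> \<sigma>" "\<sigma> > 0"
  obtains c where "(\<lambda>k. norm (c k) * exp (2 * pi * \<sigma> * eta_norm \<eta> k)) summable_on int_vecs \<eta>"
    "(\<lambda>k. norm (c k)) summable_on int_vecs \<eta>"
    "\<And>x. x \<in> torus \<Longrightarrow> ((\<lambda>k. c k * cis (2 * pi * int_dot k x)) has_sum on_torus u x) (int_vecs \<eta>)"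
proof -
  obtain c where c: "(\<lambda>k. norm (c k) * exp (2 * pi * \<sigma> * eta_norm \<eta> k)) summable_on int_vecs \<eta>"
    "\<And>x. x \<in> complex_torus \<eta> \<sigma> \<Longrightarrow>
      ((\<lambda>k. c k * exp (2 * of_real pi * \<i> * int_dot k x)) has_sum u x) (int_vecs \<eta>)"
    using assms(1) unfolding analytic_space_def by blast
  have "(\<lambda>k. norm (c k)) summable_on int_vecs \<eta>"
  proof (rule Infinite_Sum.abs_summable_on_comparison_test'[OF c(1)])
    fix k assume "k \<in> int_vecs \<eta>"
    then have "1 \<le> exp (2 * pi * \<sigma> * eta_norm \<eta> k)"
      using assms(2) eta_norm_nonneg[of k \<eta>] by simp
    then show "norm (c k) \<le> norm (c k) * exp (2 * pi * \<sigma> * eta_norm \<eta> k)"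
      using mult_left_mono[of 1 _ "norm (c k)"] by simp
  qed
  moreover have "((\<lambda>k. c k * cis (2 * pi * int_dot k x)) has_sum on_torus u x) (int_vecs \<eta>)"
    if "x \<in> torus" for x
  proof -
    have "(\<lambda>j. complex_of_real (x j)) \<in> complex_torus \<eta> \<sigma>"
      using that assms(2) jbracket_ge_1 by (auto simp: complex_torus_def torus_def jbracket_def)
    from c(2)[OF this] show ?thesis
      unfolding on_torus_def
      by (rule has_sum_cong[THEN iffD1, rotated]) (simp add: exp_int_dot_of_real)
  qed
  ultimately show ?thesis using that c(1) by blast
qed

lemma prob_space_circle: "prob_space (restrict_space lborel {0..<1::real})"
  by (rule prob_spaceI) (simp add: emeasure_restrict_space space_restrict_space)

interpretation circle_power: product_prob_space "\<lambda>_::nat. restrict_space lborel {0..<1::real}" UNIV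
proof -
  interpret prob_space "restrict_space lborel {0..<1::real}"
    by (rule prob_space_circle)
  show "product_prob_space (\<lambda>_::nat. restrict_space lborel {0..<1::real})"
    by unfold_locales
qed

lemma space_torus_measure: "space torus_measure = torus"
  by (auto simp: torus_measure_def torus_def space_PiM space_restrict_space PiE_def Pi_def extensional_def)

lemma cis_measurable [measurable]: "cis \<in> borel_measurable borel"
  unfolding cis_conv_exp[abs_def] by measurable

lemma integral_circle_cis:
  "(LINT t|restrict_space lborel {0..<1}. cis (2 * pi * (real_of_int n * t))) = (if n = 0 then 1 else 0)"
proof (cases "n = 0")
  case True
  then show ?thesis
    using prob_space.prob_space[OF prob_space_circle] by simp
next
  case False
  define c where "c = 2 * pi * real_of_int n"
  have c: "c \<noteq> 0" using False by (simp add: c_def)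
  have "(LINT t|restrict_space lborel {0..<1}. cis (2 * pi * (real_of_int n * t)))
      = (LINT t|lborel. indicator {0..<1} t *\<^sub>R cis (c * t))"
    by (subst integral_restrict_space) (auto simp: c_def ac_simps)
  also have "\<dots> = (LINT t|lborel. indicator {0..1} t *\<^sub>R cis (c * t))"
    by (rule integral_cong_AE) (use AE_lborel_singleton[of "1::real"] in \<open>auto simp: indicator_def elim!: eventually_mono\<close>)
  also have "\<dots> = cis (c * 1) / (\<i> * c) - cis (c * 0) / (\<i> * c)"
  proof (rule integral_FTC_Icc)
    fix x :: real assume "0 \<le> x" "x \<le> 1"
    show "((\<lambda>x. cis (c * x) / (\<i> * c)) has_vector_derivative cis (c * x)) (at x within {0..1})"
      unfolding cis_conv_exp using c
      by (auto intro!: derivative_eq_intros has_vector_derivative_real_field simp: field_simps)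
  qed (auto simp: cis_conv_exp intro!: continuous_intros)
  also have "cis (c * 1) = 1"
    using cis_multiple_2pi[of "real_of_int n"] by (simp add: c_def)
  finally show ?thesis using False by simp
qed

lemma int_dot_measurable [measurable]:
  "(\<lambda>x. int_dot k x :: real) \<in> borel_measurable torus_measure"
proof -
  have [measurable]: "(\<lambda>x. x j) \<in> borel_measurable torus_measure" for j
    unfolding torus_measure_def
    by (rule measurable_compose[OF measurable_component_singleton]) (auto intro: measurable_restrict_space1)
  show ?thesis unfolding int_dot_def by measurable
qed

text \<open>A character depends on finitely many coordinates only, so its integral is a finite product of
integrals over the circle.\<close>

lemma integral_torus_character:
  assumes "k \<in> int_vecs \<eta>"
  shows "(LINT x|torus_measure. cis (2 * pi * int_dot k x)) = (if k = (\<lambda>_. 0) then 1 else 0)"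
proof -
  define J where "J = {j. k j \<noteq> 0}"
  have J: "finite J" using finite_support_int_vecs[OF assms] by (simp add: J_def)
  let ?M = "\<lambda>_::nat. restrict_space lborel {0..<1::real}"
  define e where "e n t = cis (2 * pi * (real_of_int n * t))" for n t
  have e_meas [measurable]: "e n \<in> borel_measurable (restrict_space lborel {0..<1})" for n
    unfolding e_def by (intro measurable_restrict_space1) measurable
  have "cis (2 * pi * int_dot k x) = (\<Prod>j\<in>J. e (k j) (restrict x J j))" for x
    using J unfolding int_dot_finite[OF assms] J_def[symmetric] e_def cis_conv_exp
    by (simp add: exp_sum[symmetric] sum_distrib_left ac_simps)
  then have "(LINT x|torus_measure. cis (2 * pi * int_dot k x))
      = (LINT x|PiM UNIV ?M. (\<Prod>j\<in>J. e (k j) (restrict x J j)))"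
    by (simp add: torus_measure_def)
  also have "\<dots> = (LINT x|distr (PiM UNIV ?M) (PiM J ?M) (\<lambda>x. restrict x J). (\<Prod>j\<in>J. e (k j) (x j)))"
    by (subst integral_distr) auto
  also have "\<dots> = (LINT x|PiM J ?M. (\<Prod>j\<in>J. e (k j) (x j)))"
    using circle_power.distr_PiM_restrict_finite[OF J] by simp
  also have "\<dots> = (\<Prod>j\<in>J. integral\<^sup>L (restrict_space lborel {0..<1}) (e (k j)))"
  proof (rule circle_power.product_integral_prod[OF J])
    show "integrable (restrict_space lborel {0..<1}) (e (k j))" for j
      by (rule finite_measure.integrable_const_bound[OF prob_space.finite_measure[OF prob_space_circle], of _ 1]) (auto simp: e_def)
  qed
  also have "\<dots> = (\<Prod>j\<in>J. if k j = 0 then 1 else 0)"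
    unfolding e_def integral_circle_cis ..
  also have "\<dots> = (if k = (\<lambda>_. 0) then 1 else 0)"
    using J by (auto simp: J_def card_gt_0_iff fun_eq_iff)
  finally show ?thesis .
qed

lemma integral_torus_fourier:
  assumes "(\<lambda>k. norm (c k)) summable_on int_vecs \<eta>"
    "\<And>x. x \<in> torus \<Longrightarrow> ((\<lambda>k. c k * cis (2 * pi * int_dot k x)) has_sum on_torus u x) (int_vecs \<eta>)"
  shows "(LINT x|torus_measure. on_torus u x) = c (\<lambda>_. 0)"
proof -
  interpret T: prob_space torus_measure
    unfolding torus_measure_def by (rule circle_power.P.prob_space_axioms)
  have "((\<lambda>k. LINT x|torus_measure. c k * cis (2 * pi * int_dot k x)) has_sum
      (LINT x|torus_measure. on_torus u x)) (int_vecs \<eta>)"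
    by (rule has_sum_integral_dominated[where g = "\<lambda>_. 1", OF _ has_sum_infsum[OF assms(1)]])
       (use assms(2) in \<open>auto simp: space_torus_measure norm_mult\<close>)
  moreover have "((\<lambda>k. LINT x|torus_measure. c k * cis (2 * pi * int_dot k x)) has_sum c (\<lambda>_. 0)) (int_vecs \<eta>)"
  proof (rule has_sum_finite_neutralI)
    show "{\<lambda>_. 0} \<subseteq> int_vecs \<eta>" by (simp add: zero_in_int_vecs)
  qed (auto simp: integral_torus_character[of _ \<eta>] zero_in_int_vecs)
  ultimately show ?thesis by (rule has_sum_unique)
qed

section \<open>Small divisors\<close>

text \<open>The reciprocal of the product in the Diophantine condition, for a single component \<open>k\<close>; the product
runs over the support, where all factors different from 1 are located.\<close>

definition dioph_weight :: "real \<Rightarrow> (nat \<Rightarrow> int) \<Rightarrow> real" where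
  "dioph_weight \<mu> k = (\<Prod>j | k j \<noteq> 0. 1 + \<bar>real_of_int (k j)\<bar> powr \<mu> * jbracket j powr \<mu>)"

lemma dioph_weight_ge_1: "dioph_weight \<mu> k \<ge> 1"
  unfolding dioph_weight_def by (intro prod_ge_1) simp

lemma dioph_bound_eq:
  assumes "k \<in> joint_int_vecs \<eta> l"
  shows "dioph_bound \<gamma> \<mu> l k = \<gamma> / (\<Prod>i=1..l. dioph_weight \<mu> (k i))"
proof -
  have "prodinf (\<lambda>j. inverse (1 + \<bar>real_of_int (k i j)\<bar> powr \<mu> * jbracket j powr \<mu>)) =
      inverse (dioph_weight \<mu> (k i))" if "i \<in> {1..l}" for i
  proof -
    have "k i \<in> int_vecs \<eta>" using assms that by (simp add: joint_int_vecs_def)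
    then have "prodinf (\<lambda>j. inverse (1 + \<bar>real_of_int (k i j)\<bar> powr \<mu> * jbracket j powr \<mu>)) =
        (\<Prod>j | k i j \<noteq> 0. inverse (1 + \<bar>real_of_int (k i j)\<bar> powr \<mu> * jbracket j powr \<mu>))"
      by (intro prodinf_finite finite_support_int_vecs) auto
    then show ?thesis
      by (simp add: dioph_weight_def prod_inversef[unfolded o_def])
  qed
  then have "dioph_bound \<gamma> \<mu> l k = \<gamma> * (\<Prod>i=1..l. inverse (dioph_weight \<mu> (k i)))"
    by (simp add: dioph_bound_def)
  also have "(\<Prod>i=1..l. inverse (dioph_weight \<mu> (k i))) = inverse (\<Prod>i=1..l. dioph_weight \<mu> (k i))"
    by (simp add: prod_inversef[unfolded o_def])
  finally show ?thesis by (simp add: divide_inverse)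
qed

text \<open>Small \<open>\<epsilon>\<close> gives slow exponential growth at the price of a large constant.\<close>

lemma one_plus_powr_le:
  fixes y \<mu> \<epsilon> :: real
  assumes "1 \<le> y" "0 < \<epsilon>" and nonneg: "\<mu> \<ge> 0"
  shows "1 + y powr \<mu> \<le> 2 * \<epsilon> powr (- \<mu>) * exp (\<mu> * \<epsilon> * y)"
proof -
  have "1 \<le> y powr \<mu>" using assms nonneg by (intro ge_one_powr_ge_zero) auto
  then have le: "1 + y powr \<mu> \<le> 2 * y powr \<mu>" by simp
  have "y powr \<mu> = \<epsilon> powr (- \<mu>) * (\<epsilon> * y) powr \<mu>"
    using assms by (simp add: powr_mult powr_minus)
  also have "(\<epsilon> * y) powr \<mu> \<le> exp (\<mu> * \<epsilon> * y)"
    using assms nonneg mult_left_mono[OF ln_bound[of "\<epsilon> * y"], of \<mu>] by (simp add: powr_def mult.assoc)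
  finally have "y powr \<mu> \<le> \<epsilon> powr (- \<mu>) * exp (\<mu> * \<epsilon> * y)"
    by (simp add: mult_left_mono)
  with le show ?thesis
    by linarith
qed

text \<open>This is what makes the small divisors harmless. For \<open>k j \<noteq> 0\<close> put \<open>y = \<bar>k j\<bar> \<langle>j\<rangle>\<close>. The factor of
index \<open>j\<close> grows like a power of \<open>y\<close>, and since \<open>\<eta> \<ge> 2\<close> the corresponding term of the exponent is at
least \<open>\<delta> \<langle>j\<rangle> y\<close>. Hence the exponential dominates the factor with constant 1 as soon as \<open>\<langle>j\<rangle>\<close> is large.
The finitely many remaining indices contribute a constant \<open>D\<close> each, so that the
total constant \<open>D ^ J\<close> does not depend on the size of the support of \<open>k\<close>.\<close>

lemma dioph_weight_subexponential:
  fixes \<mu> \<delta> :: real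
  assumes "\<eta> \<ge> 2" "\<delta> > 0" "\<mu> \<ge> 0"
  shows "\<exists>C>0. \<forall>k\<in>int_vecs \<eta>. dioph_weight \<mu> k ^ m \<le> C * exp (\<delta> * eta_norm \<eta> k)"
proof -
  \<comment> \<open>The 1 in the denominator only avoids division by zero when \<open>m = 0\<close> or \<open>\<mu> = 0\<close>.\<close>
  define \<epsilon> where "\<epsilon> = min 1 (\<delta> / (real m * \<mu> + 1))"
  have \<epsilon>: "0 < \<epsilon>" "\<epsilon> \<le> 1" "real m * \<mu> * \<epsilon> \<le> \<delta>"
  proof -
    show "0 < \<epsilon>" "\<epsilon> \<le> 1" using assms by (auto simp: \<epsilon>_def add_nonneg_pos)
    have "real m * \<mu> * \<epsilon> \<le> (real m * \<mu> + 1) * (\<delta> / (real m * \<mu> + 1))"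
      using assms by (intro mult_mono) (auto simp: \<epsilon>_def)
    also have "\<dots> = \<delta>"
      using assms by (simp add: add_nonneg_eq_0_iff)
    finally show "real m * \<mu> * \<epsilon> \<le> \<delta>" .
  qed
  define D where "D = (2 * \<epsilon> powr (- \<mu>)) ^ m"
  have D: "D \<ge> 1"
  proof -
    have "\<epsilon> powr \<mu> \<le> 1"
      using \<epsilon> assms powr_mono2[of \<mu> \<epsilon> 1] by simp
    then have "1 \<le> \<epsilon> powr (- \<mu>)"
      using \<epsilon>(1) by (simp add: powr_minus field_simps)
    then show ?thesis
      unfolding D_def by (intro one_le_power) simp
  qed
  \<comment> \<open>From index \<open>J\<close> on, \<open>\<delta> \<langle>j\<rangle>\<close> is at least \<open>m (\<mu> + 1)\<close>; the 1 added to \<open>\<mu>\<close> pays for the factor 2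
    in the bound of \<open>1 + y powr \<mu>\<close>.\<close>
  define J where "J = nat \<lceil>real m * (\<mu> + 1) / \<delta>\<rceil>"
  define E where "E j = (if j < J then D else 1)" for j
  have factor: "(1 + \<bar>real_of_int n\<bar> powr \<mu> * jbracket j powr \<mu>) ^ m
      \<le> E j * exp (\<delta> * (jbracket j ^ \<eta> * \<bar>real_of_int n\<bar>))" if n: "n \<noteq> 0" for n j
  proof -
    define y where "y = \<bar>real_of_int n\<bar> * jbracket j"
    have n1: "1 \<le> \<bar>real_of_int n\<bar>" using n by linarith
    have y: "1 \<le> y"
      using mult_mono[OF n1 jbracket_ge_1[of j]] by (simp add: y_def)
    have eq: "\<bar>real_of_int n\<bar> powr \<mu> * jbracket j powr \<mu> = y powr \<mu>"
      using jbracket_ge_1[of j] by (simp add: y_def powr_mult)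
    have pow: "jbracket j * jbracket j \<le> jbracket j ^ \<eta>"
      using power_increasing[OF assms(1) jbracket_ge_1[of j]] by (simp add: power2_eq_square)
    show ?thesis
    proof (cases "j < J")
      case True
      have "(1 + y powr \<mu>) ^ m \<le> (2 * \<epsilon> powr (- \<mu>) * exp (\<mu> * \<epsilon> * y)) ^ m"
        using one_plus_powr_le[OF y \<epsilon>(1) assms(3)] by (intro power_mono) auto
      also have "\<dots> = D * exp (real m * \<mu> * \<epsilon> * y)"
        by (simp add: D_def power_mult_distrib exp_of_nat_mult[symmetric] ac_simps)
      also have "real m * \<mu> * \<epsilon> * y \<le> \<delta> * (jbracket j ^ \<eta> * \<bar>real_of_int n\<bar>)"
      proof -
        have "real m * \<mu> * \<epsilon> * y \<le> \<delta> * y"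
          using \<epsilon> y by (intro mult_right_mono) auto
        also have "\<dots> \<le> \<delta> * (jbracket j ^ \<eta> * \<bar>real_of_int n\<bar>)"
          unfolding y_def mult.commute[of _ "jbracket j"]
          using assms jbracket_ge_1[of j] self_le_power[of "jbracket j" \<eta>]
          by (intro mult_left_mono mult_right_mono) auto
        finally show ?thesis .
      qed
      finally show ?thesis
        using True D by (simp add: eq E_def)
    next
      case False
      have "real m * (\<mu> + 1) / \<delta> \<le> real J"
        by (simp add: J_def real_nat_ceiling_ge)
      also have "\<dots> \<le> jbracket j"
        using False by (simp add: jbracket_def)
      finally have large: "real m * (\<mu> + 1) \<le> \<delta> * jbracket j"
        using assms by (simp add: field_simps)
      have "1 + y powr \<mu> \<le> 2 * exp (\<mu> * y)"
        using one_plus_powr_le[OF y _ assms(3), of 1] by simp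
      also have "2 \<le> exp y"
        using exp_ge_add_one_self[of y] y by linarith
      finally have "1 + y powr \<mu> \<le> exp ((\<mu> + 1) * y)"
        by (simp add: exp_add algebra_simps)
      then have "(1 + y powr \<mu>) ^ m \<le> exp ((\<mu> + 1) * y) ^ m"
        by (intro power_mono) auto
      also have "\<dots> = exp (real m * (\<mu> + 1) * y)"
        by (simp add: exp_of_nat_mult[symmetric] ac_simps)
      also have "real m * (\<mu> + 1) * y \<le> \<delta> * (jbracket j ^ \<eta> * \<bar>real_of_int n\<bar>)"
      proof -
        have "real m * (\<mu> + 1) * y \<le> \<delta> * jbracket j * y"
          using large y by (intro mult_right_mono) auto
        also have "\<dots> = \<delta> * (jbracket j * jbracket j * \<bar>real_of_int n\<bar>)"
          by (simp add: y_def)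
        also have "\<dots> \<le> \<delta> * (jbracket j ^ \<eta> * \<bar>real_of_int n\<bar>)"
          using assms pow by (intro mult_left_mono mult_right_mono) auto
        finally show ?thesis .
      qed
      finally show ?thesis
        using False by (simp add: eq E_def)
    qed
  qed
  have "dioph_weight \<mu> k ^ m \<le> D ^ J * exp (\<delta> * eta_norm \<eta> k)" if k: "k \<in> int_vecs \<eta>" for k
  proof -
    let ?S = "{j. k j \<noteq> 0}"
    have S: "finite ?S" by (rule finite_support_int_vecs[OF k])
    have norm_eq: "eta_norm \<eta> k = (\<Sum>j\<in>?S. jbracket j ^ \<eta> * \<bar>real_of_int (k j)\<bar>)"
      unfolding eta_norm_def by (rule suminf_finite) (use S in auto)
    have "dioph_weight \<mu> k ^ m \<le> (\<Prod>j\<in>?S. E j * exp (\<delta> * (jbracket j ^ \<eta> * \<bar>real_of_int (k j)\<bar>)))"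
      unfolding dioph_weight_def prod_power_distrib by (intro prod_mono) (use factor in auto)
    also have "\<dots> = (\<Prod>j\<in>?S. E j) * exp (\<delta> * eta_norm \<eta> k)"
      using S by (simp add: prod.distrib norm_eq sum_distrib_left exp_sum)
    also have "(\<Prod>j\<in>?S. E j) = D ^ card (?S \<inter> {..<J})"
      using S by (simp add: E_def prod.If_cases lessThan_def Int_def)
    also have "\<dots> \<le> D ^ J"
      using D card_mono[of "{..<J}" "?S \<inter> {..<J}"] by (intro power_increasing) auto
    finally show ?thesis by simp
  qed
  moreover have "D ^ J > 0" using D by simp
  ultimately show ?thesis by blast
qed

lemma prod_cis: "(\<Prod>i\<in>I. cis (f i)) = cis (\<Sum>i\<in>I. f i)"
  by (induction I rule: infinite_finite_induct) (auto simp: cis_mult)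

section \<open>The error of the averages\<close>

text \<open>Fixed absolutely convergent Fourier expansions of the observables on the real torus, with
exponentially decaying coefficients.\<close>

locale fourier_data =
  fixes l \<eta> :: nat and \<sigma> :: real and \<rho> :: "nat \<Rightarrow> nat \<Rightarrow> real"
    and F :: "nat \<Rightarrow> (nat \<Rightarrow> complex) \<Rightarrow> complex" and \<theta> :: "nat \<Rightarrow> real"
    and c :: "nat \<Rightarrow> (nat \<Rightarrow> int) \<Rightarrow> complex"
  assumes eta: "\<eta> \<ge> 2" and sigma: "\<sigma> > 0"
    and c_exp: "\<And>i. i \<in> {1..l} \<Longrightarrow>
      (\<lambda>k. norm (c i k) * exp (2 * pi * \<sigma> * eta_norm \<eta> k)) summable_on int_vecs \<eta>"
    and c_abs: "\<And>i. i \<in> {1..l} \<Longrightarrow> (\<lambda>k. norm (c i k)) summable_on int_vecs \<eta>"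
    and c_sum: "\<And>i x. i \<in> {1..l} \<Longrightarrow> x \<in> torus \<Longrightarrow>
      ((\<lambda>k. c i k * cis (2 * pi * int_dot k x)) has_sum on_torus (F i) x) (int_vecs \<eta>)"
begin

definition modes :: "(nat \<Rightarrow> nat \<Rightarrow> int) set" where
  "modes = PiE {1..l} (\<lambda>_. int_vecs \<eta>)"

definition zero_mode :: "nat \<Rightarrow> nat \<Rightarrow> int" where
  "zero_mode = restrict (\<lambda>_ _. 0) {1..l}"

definition coef :: "(nat \<Rightarrow> nat \<Rightarrow> int) \<Rightarrow> complex" where
  "coef k = (\<Prod>i=1..l. c i (k i) * cis (2 * pi * int_dot (k i) \<theta>))"

lemma modes_joint: "k \<in> modes \<Longrightarrow> k \<in> joint_int_vecs \<eta> l"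
  by (auto simp: modes_def joint_int_vecs_def PiE_iff)

lemma zero_mode_in: "zero_mode \<in> modes"
  by (auto simp: modes_def zero_mode_def zero_in_int_vecs)

lemma nonzero_mode: "k \<in> modes \<Longrightarrow> k \<noteq> zero_mode \<Longrightarrow> joint_nonzero l k"
  unfolding joint_nonzero_def
proof (rule ccontr)
  assume k: "k \<in> modes" "k \<noteq> zero_mode" and "\<not> (\<exists>i\<in>{1..l}. \<exists>j. k i j \<noteq> 0)"
  then have "k i = zero_mode i" for i
    by (cases "i \<in> {1..l}") (auto simp: modes_def zero_mode_def PiE_iff extensional_def fun_eq_iff)
  with k(2) show False by auto
qed

lemma joint_dot_zero_mode: "joint_dot l zero_mode \<rho> = 0"
  by (simp add: joint_dot_def zero_mode_def int_dot_def)

lemma norm_coef: "norm (coef k) = (\<Prod>i=1..l. norm (c i (k i)))"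
  by (simp add: coef_def norm_mult flip: prod_norm)

text \<open>The zeroth Fourier coefficient of each observable is its mean.\<close>

lemma coef_zero_mode: "coef zero_mode = (\<Prod>i=1..l. LINT x|torus_measure. on_torus (F i) x)"
  unfolding coef_def
proof (rule prod.cong)
  fix i assume i: "i \<in> {1..l}"
  then show "c i (zero_mode i) * cis (2 * pi * int_dot (zero_mode i) \<theta>) = (LINT x|torus_measure. on_torus (F i) x)"
    using integral_torus_fourier[OF c_abs[OF i] c_sum[OF i]] by (simp add: zero_mode_def int_dot_def)
qed simp

text \<open>Along the orbit, the product of the observables is an almost periodic function of time with
frequencies \<open>joint_dot l k \<rho>\<close>.\<close>

lemma product_along_orbit:
  "((\<lambda>k. coef k * cis (2 * pi * (s * joint_dot l k \<rho>))) has_sum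
     (\<Prod>i=1..l. on_torus (F i) (torus_rot (\<rho> i) s \<theta>))) modes"
proof -
  have "((\<lambda>k. \<Prod>i=1..l. c i (k i) * cis (2 * pi * int_dot (k i) (torus_rot (\<rho> i) s \<theta>))) has_sum
     (\<Prod>i=1..l. on_torus (F i) (torus_rot (\<rho> i) s \<theta>))) modes"
    unfolding modes_def
    by (rule has_sum_prod_PiE) (use c_abs c_sum torus_rot_in_torus in \<open>auto simp: norm_mult\<close>)
  also have "((\<lambda>k. \<Prod>i=1..l. c i (k i) * cis (2 * pi * int_dot (k i) (torus_rot (\<rho> i) s \<theta>))) has_sum
     (\<Prod>i=1..l. on_torus (F i) (torus_rot (\<rho> i) s \<theta>))) modes \<longleftrightarrow> ?thesis"
  proof (rule has_sum_cong)
    fix k assume k: "k \<in> modes"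
    have "(\<Prod>i=1..l. c i (k i) * cis (2 * pi * int_dot (k i) (torus_rot (\<rho> i) s \<theta>)))
       = (\<Prod>i=1..l. (c i (k i) * cis (2 * pi * int_dot (k i) \<theta>)) * cis (2 * pi * (s * int_dot (k i) (\<rho> i))))"
      by (intro prod.cong refl) (use k in \<open>auto simp: cis_int_dot_torus_rot[of _ \<eta>] modes_def PiE_iff\<close>)
    also have "\<dots> = coef k * cis (\<Sum>i=1..l. 2 * pi * (s * int_dot (k i) (\<rho> i)))"
      by (simp only: prod.distrib prod_cis coef_def)
    also have "(\<Sum>i=1..l. 2 * pi * (s * int_dot (k i) (\<rho> i))) = 2 * pi * (s * joint_dot l k \<rho>)"
      by (simp add: joint_dot_def sum_distrib_left)
    finally show "(\<Prod>i=1..l. c i (k i) * cis (2 * pi * int_dot (k i) (torus_rot (\<rho> i) s \<theta>)))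
       = coef k * cis (2 * pi * (s * joint_dot l k \<rho>))" .
  qed
  finally show ?thesis .
qed

lemma coef_abs_summable: "(\<lambda>k. norm (coef k)) summable_on modes"
  unfolding norm_coef modes_def by (rule summable_on_prod_PiE) (use c_abs in auto)

lemma coef_weight_summable:
  assumes "\<mu> \<ge> 0"
  shows "(\<lambda>k. norm (coef k) * (\<Prod>i=1..l. dioph_weight \<mu> (k i)) ^ m) summable_on modes"
proof -
  obtain C where C: "C > 0" "\<And>k. k \<in> int_vecs \<eta> \<Longrightarrow> dioph_weight \<mu> k ^ m \<le> C * exp (2 * pi * \<sigma> * eta_norm \<eta> k)"
    using dioph_weight_subexponential[OF eta _ assms, of "2 * pi * \<sigma>" m] sigma by auto
  have "(\<lambda>k. \<Prod>i=1..l. norm (c i (k i)) * dioph_weight \<mu> (k i) ^ m) summable_on modes"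
    unfolding modes_def
  proof (rule summable_on_prod_PiE)
    have nonneg: "0 \<le> dioph_weight \<mu> k ^ m" for k
      using dioph_weight_ge_1[of \<mu> k] by simp
    then show "0 \<le> norm (c i k) * dioph_weight \<mu> k ^ m" for i k by simp
    show "(\<lambda>k. norm (c i k) * dioph_weight \<mu> k ^ m) summable_on int_vecs \<eta>" if "i \<in> {1..l}" for i
    proof (rule summable_on_comparison_test)
      show "(\<lambda>k. C * (norm (c i k) * exp (2 * pi * \<sigma> * eta_norm \<eta> k))) summable_on int_vecs \<eta>"
        by (intro summable_on_cmult_right c_exp that)
      show "norm (c i k) * dioph_weight \<mu> k ^ m \<le> C * (norm (c i k) * exp (2 * pi * \<sigma> * eta_norm \<eta> k))"
        if "k \<in> int_vecs \<eta>" for k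
        using mult_left_mono[OF C(2)[OF that], of "norm (c i k)"] by (simp add: ac_simps)
    qed (use nonneg in simp)
  qed simp
  then show ?thesis
    by (simp add: norm_coef prod.distrib prod_power_distrib)
qed

text \<open>The common last step of both cases. Here \<open>V k\<close> is the weighted average of the character with
mode \<open>k\<close>, and \<open>X\<close> carries the whole dependence on the averaging time: the remaining sum is
finite and independent of it.\<close>

lemma average_bound:
  assumes "\<mu> \<ge> 0" "X \<ge> 0"
    and S: "((\<lambda>k. coef k * V k) has_sum S) modes" and V0: "V zero_mode = 1"
    and V: "\<And>k. k \<in> modes \<Longrightarrow> joint_nonzero l k \<Longrightarrow>
      norm (V k) \<le> X * (\<Prod>i=1..l. dioph_weight \<mu> (k i)) ^ m"
  shows "norm (S - (\<Prod>i=1..l. LINT x|torus_measure. on_torus (F i) x))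
    \<le> X * infsum (\<lambda>k. norm (coef k) * (\<Prod>i=1..l. dioph_weight \<mu> (k i)) ^ m) (modes - {zero_mode})"
proof -
  let ?w = "\<lambda>k. norm (coef k) * (\<Prod>i=1..l. dioph_weight \<mu> (k i)) ^ m"
  have "((\<lambda>k. coef k * V k) has_sum (S - coef zero_mode)) (modes - {zero_mode})"
    using has_sum_Diff[OF S has_sum_finite[of "{zero_mode}"]] zero_mode_in V0 by simp
  moreover have "(?w has_sum infsum ?w (modes - {zero_mode})) (modes - {zero_mode})"
    by (intro has_sum_infsum summable_on_subset_banach[OF coef_weight_summable[OF assms(1)]]) auto
  then have "((\<lambda>k. X * ?w k) has_sum X * infsum ?w (modes - {zero_mode})) (modes - {zero_mode})"
    by (rule has_sum_cmult_right)
  moreover have "norm (coef k * V k) \<le> X * ?w k" if "k \<in> modes - {zero_mode}" for k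
    using mult_left_mono[OF V[of k], of "norm (coef k)"] nonzero_mode[of k] that
    by (simp add: norm_mult ac_simps)
  ultimately have "norm (S - coef zero_mode - sum (\<lambda>k. coef k * V k) {})
      \<le> X * infsum ?w (modes - {zero_mode}) - sum (\<lambda>k. X * ?w k) {}"
    by (rule has_sum_tail_bound) auto
  then show ?thesis by (simp add: coef_zero_mode)
qed

lemma discrete_average_bound:
  assumes "joint_dioph_discrete \<eta> l \<rho>"
  shows "\<exists>K. \<forall>N\<ge>4. norm (DMW l \<rho> F N \<theta> - (\<Prod>i=1..l. LINT x|torus_measure. on_torus (F i) x))
    \<le> K / real N ^ m"
proof -
  obtain \<gamma> \<mu> where \<gamma>: "\<gamma> > 0" and \<mu>: "\<mu> > 1" and dioph:
    "\<And>k n. k \<in> joint_int_vecs \<eta> l \<Longrightarrow> joint_nonzero l k \<Longrightarrow>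
       dioph_bound \<gamma> \<mu> l k < \<bar>joint_dot l k \<rho> - real_of_int n\<bar>"
    using assms unfolding joint_dioph_discrete_def by blast
  obtain C where C: "C \<ge> 0" "\<And>N z. N \<ge> 1 \<Longrightarrow> norm z = 1 \<Longrightarrow>
     norm (1 - z) ^ m * norm (\<Sum>n<N. complex_of_real (weight (real n / real N)) * z ^ n)
       \<le> C * real N / real N ^ m"
    using weighted_exponential_sum_bound[of m] by blast
  obtain d where d: "d > 0" "\<And>N. N \<ge> 4 \<Longrightarrow> d * real N \<le> (\<Sum>n<N. weight (real n / real N))"
    using sum_weight_ge by blast
  define W where "W k = (\<Prod>i=1..l. dioph_weight \<mu> (k i))" for k
  have W: "W k \<ge> 1" for k
    unfolding W_def by (intro prod_ge_1 dioph_weight_ge_1)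
  define K0 where "K0 = infsum (\<lambda>k. norm (coef k) * W k ^ m) (modes - {zero_mode})"
  define K where "K = C / (d * \<gamma> ^ m) * K0"
  have "norm (DMW l \<rho> F N \<theta> - (\<Prod>i=1..l. LINT x|torus_measure. on_torus (F i) x)) \<le> K / real N ^ m"
    if N: "N \<ge> 4" for N
  proof -
    define A where "A = (\<Sum>n<N. weight (real n / real N))"
    have A: "d * real N \<le> A" "0 < A"
      using d(2)[OF N] less_le_trans[of 0 "d * real N"] d(1) N by (auto simp: A_def)
    define V where "V k = 1 / complex_of_real A * (\<Sum>n<N. complex_of_real (weight (real n / real N)) *
       cis (2 * pi * (real n * joint_dot l k \<rho>)))" for k
    define X where "X = C / (d * \<gamma> ^ m) / real N ^ m"
    have "((\<lambda>k. 1 / complex_of_real A * (\<Sum>n<N. complex_of_real (weight (real n / real N)) *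
        (coef k * cis (2 * pi * (real n * joint_dot l k \<rho>))))) has_sum DMW l \<rho> F N \<theta>) modes"
      unfolding DMW_def A_def
      by (intro has_sum_cmult_right has_sum_sum_finite product_along_orbit) auto
    then have S: "((\<lambda>k. coef k * V k) has_sum DMW l \<rho> F N \<theta>) modes"
      by (simp add: V_def sum_distrib_left ac_simps)
    have V0: "V zero_mode = 1"
      using A(2) by (simp add: V_def joint_dot_zero_mode A_def flip: of_real_sum)
    have "norm (V k) \<le> X * W k ^ m" if k: "k \<in> modes" "joint_nonzero l k" for k
    proof -
      define z where "z = cis (2 * pi * joint_dot l k \<rho>)"
      define s where "s = norm (\<Sum>n<N. complex_of_real (weight (real n / real N)) * z ^ n)"
      have "cis (2 * pi * (real n * joint_dot l k \<rho>)) = z ^ n" for n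
        by (simp only: z_def Complex.DeMoivre mult.left_commute mult.assoc)
      then have V_eq: "norm (V k) = s / A"
        using A(2) by (simp add: V_def s_def norm_mult norm_divide)
      have "\<gamma> / W k < \<bar>joint_dot l k \<rho> - real_of_int (round (joint_dot l k \<rho>))\<bar>"
        using dioph[OF modes_joint[OF k(1)] k(2)] dioph_bound_eq[OF modes_joint[OF k(1)]]
        by (simp add: W_def)
      also have "\<dots> \<le> norm (1 - z)"
        using norm_cis_minus_one_ge[of "joint_dot l k \<rho>"] by (simp add: z_def norm_minus_commute)
      finally have "(\<gamma> / W k) ^ m * s \<le> norm (1 - z) ^ m * s"
        using \<gamma> W[of k] by (intro mult_right_mono power_mono) (auto simp: s_def)
      also have "\<dots> \<le> C * real N / real N ^ m"
        unfolding s_def by (rule C(2)) (use N in \<open>auto simp: z_def\<close>)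
      finally have "s \<le> C * real N / real N ^ m / (\<gamma> / W k) ^ m"
        using \<gamma> W[of k] by (subst pos_le_divide_eq) (auto simp: mult.commute)
      then have "s \<le> C * real N / real N ^ m * (W k / \<gamma>) ^ m"
        by (simp add: power_divide)
      then have "s / A \<le> C * real N / real N ^ m * (W k / \<gamma>) ^ m / (d * real N)"
        using A d(1) N C(1) \<gamma> W[of k] by (intro frac_le) auto
      also have "\<dots> = X * W k ^ m"
        using N by (simp add: X_def power_divide)
      finally show ?thesis by (simp add: V_eq)
    qed
    moreover have "X \<ge> 0" using C(1) d(1) \<gamma> by (simp add: X_def)
    ultimately have "norm (DMW l \<rho> F N \<theta> - (\<Prod>i=1..l. LINT x|torus_measure. on_torus (F i) x)) \<le> X * K0"
      using average_bound[OF _ _ S V0, of \<mu> X m] \<mu> by (simp add: W_def K0_def)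
    then show ?thesis by (simp add: X_def K_def)
  qed
  then show ?thesis by blast
qed

lemma continuous_average_bound:
  assumes "joint_dioph_continuous \<eta> l \<rho>"
  shows "\<exists>K. \<forall>T>0. norm (CMW l \<rho> F T \<theta> - (\<Prod>i=1..l. LINT x|torus_measure. on_torus (F i) x))
    \<le> K / T ^ m"
proof -
  obtain \<gamma> \<mu> where \<gamma>: "\<gamma> > 0" and \<mu>: "\<mu> > 1" and dioph:
    "\<And>k. k \<in> joint_int_vecs \<eta> l \<Longrightarrow> joint_nonzero l k \<Longrightarrow>
       dioph_bound \<gamma> \<mu> l k < \<bar>joint_dot l k \<rho>\<bar>"
    using assms unfolding joint_dioph_continuous_def by blast
  obtain C where C: "C \<ge> 0" "\<And>b. b \<noteq> 0 \<Longrightarrow>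
     \<bar>b\<bar> ^ m * norm (LINT x|lborel. complex_of_real (weight x) * cis (b * x)) \<le> C"
    using weight_fourier_bound[of m] by blast
  define W where "W k = (\<Prod>i=1..l. dioph_weight \<mu> (k i))" for k
  have W: "W k \<ge> 1" for k
    unfolding W_def by (intro prod_ge_1 dioph_weight_ge_1)
  define K0 where "K0 = infsum (\<lambda>k. norm (coef k) * W k ^ m) (modes - {zero_mode})"
  define K where "K = C / (2 * pi * \<gamma>) ^ m * K0"
  have "norm (CMW l \<rho> F T \<theta> - (\<Prod>i=1..l. LINT x|torus_measure. on_torus (F i) x)) \<le> K / T ^ m"
    if T: "T > 0" for T
  proof -
    define V where "V k = (LINT x|lborel. complex_of_real (weight x) * cis (2 * pi * T * joint_dot l k \<rho> * x))" for k
    define X where "X = C / (2 * pi * \<gamma>) ^ m / T ^ m"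
    have "((\<lambda>k. LINT s|lborel. indicator {0..T} s *\<^sub>R (complex_of_real (weight (s / T)) *
          (coef k * cis (2 * pi * (s * joint_dot l k \<rho>))))) has_sum
        (LINT s|lborel. indicator {0..T} s *\<^sub>R (complex_of_real (weight (s / T)) *
          (\<Prod>i=1..l. on_torus (F i) (torus_rot (\<rho> i) s \<theta>))))) modes"
    proof (rule has_sum_integral_dominated[OF integrable_weight_rescaled[OF T] has_sum_infsum[OF coef_abs_summable]])
      show "(\<lambda>s. indicator {0..T} s *\<^sub>R (complex_of_real (weight (s / T)) *
          (coef k * cis (2 * pi * (s * joint_dot l k \<rho>))))) \<in> borel_measurable lborel" for k
        by measurable
      show "norm (indicator {0..T} s *\<^sub>R (complex_of_real (weight (s / T)) *
          (coef k * cis (2 * pi * (s * joint_dot l k \<rho>))))) \<le> norm (coef k) * weight (s / T)" for k s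
        using weight_nonneg[of "s / T"] by (auto simp: norm_mult indicator_def)
      show "((\<lambda>k. indicator {0..T} s *\<^sub>R (complex_of_real (weight (s / T)) *
          (coef k * cis (2 * pi * (s * joint_dot l k \<rho>))))) has_sum
        (indicator {0..T} s *\<^sub>R (complex_of_real (weight (s / T)) *
          (\<Prod>i=1..l. on_torus (F i) (torus_rot (\<rho> i) s \<theta>))))) modes" for s
        unfolding scaleR_conv_of_real by (intro has_sum_cmult_right product_along_orbit)
    qed
    then have "((\<lambda>k. 1 / complex_of_real T * (LINT s:{0..T}|lborel. complex_of_real (weight (s / T)) *
          (coef k * cis (2 * pi * (s * joint_dot l k \<rho>))))) has_sum CMW l \<rho> F T \<theta>) modes"
      unfolding CMW_def set_lebesgue_integral_def by (rule has_sum_cmult_right)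
    moreover have "1 / complex_of_real T * (LINT s:{0..T}|lborel. complex_of_real (weight (s / T)) *
          (coef k * cis (2 * pi * (s * joint_dot l k \<rho>)))) = coef k * V k" for k
    proof -
      have "(LINT s:{0..T}|lborel. complex_of_real (weight (s / T)) *
          (coef k * cis (2 * pi * (s * joint_dot l k \<rho>)))) =
          coef k * (LINT s:{0..T}|lborel. complex_of_real (weight (s / T)) * cis (2 * pi * (s * joint_dot l k \<rho>)))"
        by (simp only: mult.left_commute[of _ "coef k"] set_integral_mult_right)
      then show ?thesis
        unfolding V_def weight_rescaled_fourier[OF T, symmetric] by simp
    qed
    ultimately have S: "((\<lambda>k. coef k * V k) has_sum CMW l \<rho> F T \<theta>) modes" by simp
    have V0: "V zero_mode = 1"
      by (simp add: V_def joint_dot_zero_mode integral_weight)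
    have "norm (V k) \<le> X * W k ^ m" if k: "k \<in> modes" "joint_nonzero l k" for k
    proof -
      have lower: "\<gamma> / W k < \<bar>joint_dot l k \<rho>\<bar>"
        using dioph[OF modes_joint[OF k(1)] k(2)] dioph_bound_eq[OF modes_joint[OF k(1)]]
        by (simp add: W_def)
      have "0 < \<gamma> / W k" using \<gamma> W[of k] by simp
      then have nz: "2 * pi * T * joint_dot l k \<rho> \<noteq> 0" using lower T by auto
      have "2 * pi * T * (\<gamma> / W k) \<le> \<bar>2 * pi * T * joint_dot l k \<rho>\<bar>"
        using mult_left_mono[OF less_imp_le[OF lower], of "2 * pi * T"] T by (simp add: abs_mult)
      then have "(2 * pi * T * (\<gamma> / W k)) ^ m * norm (V k) \<le> \<bar>2 * pi * T * joint_dot l k \<rho>\<bar> ^ m * norm (V k)"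
        using \<gamma> W[of k] T by (intro mult_right_mono power_mono) auto
      also have "\<dots> \<le> C"
        unfolding V_def by (rule C(2)[OF nz])
      finally show ?thesis
        using \<gamma> W[of k] T by (simp add: X_def power_divide power_mult_distrib field_simps)
    qed
    moreover have "X \<ge> 0" using C(1) \<gamma> T by (simp add: X_def)
    ultimately have "norm (CMW l \<rho> F T \<theta> - (\<Prod>i=1..l. LINT x|torus_measure. on_torus (F i) x)) \<le> X * K0"
      using average_bound[OF _ _ S V0, of \<mu> X m] \<mu> by (simp add: W_def K0_def)
    then show ?thesis by (simp add: X_def K_def)
  qed
  then show ?thesis by blast
qed

end

theorem theorem4p2:
  fixes l \<eta> m :: nat and \<sigma> :: real
    and \<rho> :: "nat \<Rightarrow> nat \<Rightarrow> real"
    and F :: "nat \<Rightarrow> (nat \<Rightarrow> complex) \<Rightarrow> complex"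
    and \<theta> :: "nat \<Rightarrow> real"
  assumes "l \<ge> 1" and "\<eta> \<ge> 2" and "\<sigma> > 0" and "m \<ge> 1"
    and "\<And>i j. i \<in> {1..l} \<Longrightarrow> \<rho> i j \<in> {1..2}"
    and "\<And>i. i \<in> {1..l} \<Longrightarrow> F i \<in> analytic_space \<eta> \<sigma>"
    and "\<theta> \<in> torus"
  shows "(joint_dioph_discrete \<eta> l \<rho> \<longrightarrow>
            (\<lambda>N::nat. norm (DMW l \<rho> F N \<theta> - (\<Prod>i=1..l. LINT x|torus_measure. on_torus (F i) x)))
              \<in> O[at_top](\<lambda>N. 1 / real N ^ m)) \<and>
         (joint_dioph_continuous \<eta> l \<rho> \<longrightarrow>
            (\<lambda>T::real. norm (CMW l \<rho> F T \<theta> - (\<Prod>i=1..l. LINT x|torus_measure. on_torus (F i) x)))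
              \<in> O[at_top](\<lambda>T. 1 / T ^ m))"
proof -
  have "\<forall>i\<in>{1..l}. \<exists>c. (\<lambda>k. norm (c k) * exp (2 * pi * \<sigma> * eta_norm \<eta> k)) summable_on int_vecs \<eta> \<and>
      (\<lambda>k. norm (c k)) summable_on int_vecs \<eta> \<and>
      (\<forall>x\<in>torus. ((\<lambda>k. c k * cis (2 * pi * int_dot k x)) has_sum on_torus (F i) x) (int_vecs \<eta>))"
    by (intro ballI, rule analytic_space_fourier[OF assms(6) assms(3)]) blast+
  from bchoice[OF this] obtain c where c: "\<forall>i\<in>{1..l}.
      (\<lambda>k. norm (c i k) * exp (2 * pi * \<sigma> * eta_norm \<eta> k)) summable_on int_vecs \<eta> \<and>
      (\<lambda>k. norm (c i k)) summable_on int_vecs \<eta> \<and>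
      (\<forall>x\<in>torus. ((\<lambda>k. c i k * cis (2 * pi * int_dot k x)) has_sum on_torus (F i) x) (int_vecs \<eta>))"
    by blast
  interpret fourier_data l \<eta> \<sigma> \<rho> F \<theta> c
    by unfold_locales (use assms(2,3) c in blast)+
  show ?thesis
  proof (intro conjI impI)
    assume "joint_dioph_discrete \<eta> l \<rho>"
    then obtain K where K: "\<And>N. N \<ge> 4 \<Longrightarrow>
        norm (DMW l \<rho> F N \<theta> - (\<Prod>i=1..l. LINT x|torus_measure. on_torus (F i) x)) \<le> K / real N ^ m"
      using discrete_average_bound[of m] by blast
    show "(\<lambda>N::nat. norm (DMW l \<rho> F N \<theta> - (\<Prod>i=1..l. LINT x|torus_measure. on_torus (F i) x)))
              \<in> O[at_top](\<lambda>N. 1 / real N ^ m)"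
      by (rule bigoI[of _ K], rule eventually_at_top_linorderI[of 4]) (use K in simp)
  next
    assume "joint_dioph_continuous \<eta> l \<rho>"
    then obtain K where K: "\<And>T. T > 0 \<Longrightarrow>
        norm (CMW l \<rho> F T \<theta> - (\<Prod>i=1..l. LINT x|torus_measure. on_torus (F i) x)) \<le> K / T ^ m"
      using continuous_average_bound[of m] by blast
    show "(\<lambda>T::real. norm (CMW l \<rho> F T \<theta> - (\<Prod>i=1..l. LINT x|torus_measure. on_torus (F i) x)))
              \<in> O[at_top](\<lambda>T. 1 / T ^ m)"
      by (rule bigoI[of _ K], rule eventually_at_top_linorderI[of 1]) (use K in \<open>simp add: abs_if\<close>)
  qed
qed

end
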